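(* Let $(\mathcal{A},\varphi,\psi)$ be a conditionally non-commutative probability space. Let $\{h_n^{(c)}:\mathcal{A}^n\to\mathbb{C}\}_{n\ge1}$ and $\{k_n^{(c)}:\mathcal{A}^n\to\mathbb{C}\}_{n\ge1}$ be the c-monotone and c-free cumulants of $(\mathcal{A},\varphi,\psi)$, respectively, and let $\{h'_n:\mathcal{A}^n\to\mathbb{C}\}_{n\ge1}$ be the monotone cumulants of $(\mathcal{A},\psi)$. Then $$k_n^{(c)}(a_1,\ldots,a_n)=\sum_{\substack{\pi\in\mathrm{NC}^{\mathrm{irr}}(n)\\ 1\in\pi_1}}\frac{(-1)^{|\pi|-1}}{t(\pi)!}\,h^{(c)}_{|\pi_1|}(a_1,\ldots,a_n|\pi_1)\prod_{\substack{\pi_j\in\pi\\ j\ne1}}h'_{|\pi_j|}(a_1,\ldots,a_n|\pi_j)$$ for any $n\ge1$ and $a_1,\ldots,a_n\in\mathcal{A}$, where for each $\pi$ the block containing $1$ is denoted $\pi_1$.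
   Context: A conditionally non-commutative probability space $(\mathcal{A},\varphi,\psi)$ is an associative unital complex algebra $\mathcal{A}$ with two linear functionals $\varphi,\psi:\mathcal{A}\to\mathbb{C}$, $\varphi(1_{\mathcal{A}})=\psi(1_{\mathcal{A}})=1$. $\mathrm{NC}(n)$ is the set of non-crossing partitions of $[n]=\{1,\dots,n\}$; $|\pi|$ is the number of blocks of $\pi$. $\mathrm{NC}^{\mathrm{irr}}(n)$ is the subset of irreducible ones, i.e. those in which $1$ and $n$ lie in the same block. For blocks, $\pi_j<\pi_i$ iff there are $a,b\in\pi_j$ with $a<c<b$ for all $c\in\pi_i$ ($\pi_i$ is nested in $\pi_j$). A block is outer if it is minimal for this order, inner otherwise. The nesting forest $t(\pi)$ is the forest of rooted trees whose vertices are the blocks of $\pi$, encoding the nesting order (roots are the outer blocks; it is a tree if $\pi$ is irreducible). Tree factorial: $t!=1$ for a single vertex, $t!=|t|\,t_1!\cdots t_s!$ if $t$ is obtained by attaching trees $t_1,\dots,t_s$ to a new root ($|t|$ = number of vertices); for a forest, take the product over its trees. For multilinear functionals $f_m:\mathcal{A}^m\to\mathbb{C}$ and a block $V=\{i_1<\dots<i_m\}$, $f_{|V|}(a_1,\dots,a_n|V)=f_m(a_{i_1},\dots,a_{i_m})$. Cumulants are recursively defined, for all $n\ge1$ and $a_1,\dots,a_n\in\mathcal{A}$, by: - free cumulants $\{k'_n\}$ of $(\mathcal{A},\psi)$: $\psi(a_1\cdots a_n)=\sum_{\pi\in\mathrm{NC}(n)}\prod_{V\in\pi}k'_{|V|}(a_1,\dots,a_n|V)$;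 - monotone cumulants $\{h'_n\}$ of $(\mathcal{A},\psi)$: $\psi(a_1\cdots a_n)=\sum_{\pi\in\mathrm{NC}(n)}\frac1{t(\pi)!}\prod_{V\in\pi}h'_{|V|}(a_1,\dots,a_n|V)$; - c-free cumulants $\{k^{(c)}_n\}$ of $(\mathcal{A},\varphi,\psi)$: $\varphi(a_1\cdots a_n)=\sum_{\pi\in\mathrm{NC}(n)}\prod_{V\text{ outer}}k^{(c)}_{|V|}(a_1,\dots,a_n|V)\prod_{V\text{ inner}}k'_{|V|}(a_1,\dots,a_n|V)$; - c-monotone cumulants $\{h^{(c)}_n\}$ of $(\mathcal{A},\varphi,\psi)$: $\varphi(a_1\cdots a_n)=\sum_{\pi\in\mathrm{NC}(n)}\frac1{t(\pi)!}\prod_{V\text{ outer}}h^{(c)}_{|V|}(a_1,\dots,a_n|V)\prod_{V\text{ inner}}h'_{|V|}(a_1,\dots,a_n|V)$. *)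

theory Defs
  imports Complex_Main "HOL-Library.Multiset" "HOL-Library.Disjoint_Sets"
begin

section \<open>Conditionally non-commutative probability spaces\<close>

locale cond_ncps = vector_space scale
  for scale :: "complex \<Rightarrow> 'a::ring_1 \<Rightarrow> 'a" +
  fixes \<phi> \<psi> :: "'a \<Rightarrow> complex"
  assumes mult_scale_left: "scale c x * y = scale c (x * y)"
    and mult_scale_right: "x * scale c y = scale c (x * y)"
    and linear_phi: "Vector_Spaces.linear scale (*) \<phi>"
    and linear_psi: "Vector_Spaces.linear scale (*) \<psi>"
    and phi_one: "\<phi> 1 = 1"
    and psi_one: "\<psi> 1 = 1"

section \<open>Non-crossing partitions and the nesting order\<close>

definition noncrossing :: "nat set set \<Rightarrow> bool" where
  "noncrossing \<pi> \<longleftrightarrow>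
     (\<forall>V\<in>\<pi>. \<forall>W\<in>\<pi>. V \<noteq> W \<longrightarrow>
        \<not> (\<exists>a b c d. a < b \<and> b < c \<and> c < d \<and> a \<in> V \<and> c \<in> V \<and> b \<in> W \<and> d \<in> W))"

definition NC :: "nat \<Rightarrow> nat set set set" where
  "NC n = {\<pi>. partition_on {1..n} \<pi> \<and> noncrossing \<pi>}"

definition NC_irr :: "nat \<Rightarrow> nat set set set" where
  "NC_irr n = {\<pi> \<in> NC n. \<exists>V\<in>\<pi>. 1 \<in> V \<and> n \<in> V}"

definition block_of :: "nat set set \<Rightarrow> nat \<Rightarrow> nat set" where
  "block_of \<pi> i = (THE V. V \<in> \<pi> \<and> i \<in> V)"

text \<open>\<open>nests V W\<close> is the strict order \<open>V < W\<close>: the block \<open>W\<close> is nested in the block \<open>V\<close>.\<close>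

definition nests :: "nat set \<Rightarrow> nat set \<Rightarrow> bool" where
  "nests V W \<longleftrightarrow> (\<exists>a\<in>V. \<exists>b\<in>V. \<forall>c\<in>W. a < c \<and> c < b)"

definition outer_blocks :: "nat set set \<Rightarrow> nat set set" where
  "outer_blocks \<pi> = {V \<in> \<pi>. \<not> (\<exists>W\<in>\<pi>. nests W V)}"

definition inner_blocks :: "nat set set \<Rightarrow> nat set set" where
  "inner_blocks \<pi> = \<pi> - outer_blocks \<pi>"

section \<open>Rooted trees, tree factorials and the nesting forest\<close>

text \<open>Finite non-planar rooted trees: a root together with the multiset of trees attached to it.
  A forest is a multiset of trees.\<close>

datatype rtree = Node "rtree multiset"

primrec tree_size :: "rtree \<Rightarrow> nat" where
  "tree_size (Node ts) = 1 + sum_mset (image_mset tree_size ts)"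

primrec tree_fact :: "rtree \<Rightarrow> nat" where
  "tree_fact (Node ts) = tree_size (Node ts) * prod_mset (image_mset tree_fact ts)"

definition forest_fact :: "rtree multiset \<Rightarrow> nat" where
  "forest_fact F = prod_mset (image_mset tree_fact F)"

text \<open>The blocks nested immediately below \<open>V\<close>, i.e. the covers of \<open>V\<close> in the nesting order.\<close>

definition child_blocks :: "nat set set \<Rightarrow> nat set \<Rightarrow> nat set set" where
  "child_blocks \<pi> V = {W \<in> \<pi>. nests V W \<and> \<not> (\<exists>U\<in>\<pi>. nests V U \<and> nests U W)}"

lemma nests_finite: "nests V W \<Longrightarrow> finite W"
  unfolding nests_def by (meson finite_nat_set_iff_bounded)

lemma nests_diameter_less:
  assumes "nests V W" "finite V" "W \<noteq> {}"
  shows "Max W - Min W < Max V - Min V"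
proof -
  from assms(1) obtain a b where ab: "a \<in> V" "b \<in> V" "\<forall>c\<in>W. a < c \<and> c < b"
    unfolding nests_def by blast
  have "finite W" using assms(1) by (rule nests_finite)
  then have "a < Min W" "Max W < b" "Min W \<le> Max W"
    using ab(3) assms(3) by (auto intro: order_trans[OF Min_le Max_ge])
  moreover have "Min V \<le> a" "b \<le> Max V" using ab assms(2) by auto
  ultimately show ?thesis by linarith
qed

function nesting_tree :: "nat set set \<Rightarrow> nat set \<Rightarrow> rtree" where
  "nesting_tree \<pi> V = Node (image_mset (nesting_tree \<pi>) (mset_set (child_blocks \<pi> V)))"
  by pat_completeness auto
termination
proof (relation "measures [\<lambda>(\<pi>, V). if finite V then 0 else 1,
                          \<lambda>(\<pi>, V). if V = {} then 0 else Suc (Max V - Min V)]", goal_cases)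
  case 1
  show ?case by simp
next
  case (2 \<pi> V W)
  then have "W \<in> child_blocks \<pi> V"
    by (metis count_mset_set(3) elem_mset_set finite_set_mset_mset_set infinite_set_mset_mset_set
        empty_iff)
  then have *: "nests V W" by (simp add: child_blocks_def)
  then have "V \<noteq> {}" by (auto simp: nests_def)
  then show ?case
    using nests_finite[OF *] nests_diameter_less[OF *] by auto
qed

declare nesting_tree.simps [simp del]

definition nesting_forest :: "nat set set \<Rightarrow> rtree multiset" where
  "nesting_forest \<pi> = image_mset (nesting_tree \<pi>) (mset_set (outer_blocks \<pi>))"

section \<open>Cumulants\<close>

text \<open>A family of functionals \<open>f\<^sub>m : \<A>\<^sup>m \<rightarrow> \<complex>\<close>, \<open>m \<ge> 1\<close>, is represented by one function \<open>f\<close> on lists,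
  \<open>f\<^sub>m\<close> being its restriction to the lists of length \<open>m\<close>; the value at the empty list is irrelevant.
  The arguments \<open>a\<^sub>1, \<dots>, a\<^sub>n\<close> are the values \<open>a 1, \<dots>, a n\<close> of a function \<open>a\<close>.
  Multilinearity of the cumulants is not required separately: the moment-cumulant formulas
  determine them uniquely and entail it.\<close>

definition on_block :: "('a list \<Rightarrow> complex) \<Rightarrow> (nat \<Rightarrow> 'a) \<Rightarrow> nat set \<Rightarrow> complex" where
  "on_block f a V = f (map a (sorted_list_of_set V))"

definition free_cumulants :: "('a::ring_1 \<Rightarrow> complex) \<Rightarrow> ('a list \<Rightarrow> complex) \<Rightarrow> bool" where
  "free_cumulants \<psi> k' \<longleftrightarrow>
     (\<forall>n\<ge>1. \<forall>a. \<psi> (prod_list (map a [1..<Suc n])) =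
        (\<Sum>\<pi>\<in>NC n. \<Prod>V\<in>\<pi>. on_block k' a V))"

definition monotone_cumulants :: "('a::ring_1 \<Rightarrow> complex) \<Rightarrow> ('a list \<Rightarrow> complex) \<Rightarrow> bool" where
  "monotone_cumulants \<psi> h' \<longleftrightarrow>
     (\<forall>n\<ge>1. \<forall>a. \<psi> (prod_list (map a [1..<Suc n])) =
        (\<Sum>\<pi>\<in>NC n. 1 / of_nat (forest_fact (nesting_forest \<pi>)) * (\<Prod>V\<in>\<pi>. on_block h' a V)))"

definition cfree_cumulants ::
    "('a::ring_1 \<Rightarrow> complex) \<Rightarrow> ('a \<Rightarrow> complex) \<Rightarrow> ('a list \<Rightarrow> complex) \<Rightarrow> bool" where
  "cfree_cumulants \<phi> \<psi> kc \<longleftrightarrow>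
     (\<exists>k'. free_cumulants \<psi> k' \<and>
       (\<forall>n\<ge>1. \<forall>a. \<phi> (prod_list (map a [1..<Suc n])) =
          (\<Sum>\<pi>\<in>NC n. (\<Prod>V\<in>outer_blocks \<pi>. on_block kc a V) *
                      (\<Prod>V\<in>inner_blocks \<pi>. on_block k' a V))))"

definition cmonotone_cumulants ::
    "('a::ring_1 \<Rightarrow> complex) \<Rightarrow> ('a \<Rightarrow> complex) \<Rightarrow> ('a list \<Rightarrow> complex) \<Rightarrow> bool" where
  "cmonotone_cumulants \<phi> \<psi> hc \<longleftrightarrow>
     (\<exists>h'. monotone_cumulants \<psi> h' \<and>
       (\<forall>n\<ge>1. \<forall>a. \<phi> (prod_list (map a [1..<Suc n])) =
          (\<Sum>\<pi>\<in>NC n. 1 / of_nat (forest_fact (nesting_forest \<pi>)) *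
                      (\<Prod>V\<in>outer_blocks \<pi>. on_block hc a V) *
                      (\<Prod>V\<in>inner_blocks \<pi>. on_block h' a V))))"

end

theory Submission
  imports Defs "HOL-Analysis.Derivative"
begin

text \<open>
  With the arguments \<open>a\<close> fixed, a family of functionals becomes a function on finite sets of naturals,
  a set \<open>S\<close> standing for the word of the \<open>a i\<close>, \<open>i \<in> S\<close>, in increasing order. For two such
  functions let \<open>gap_comp f g S\<close> be the sum over \<open>V \<subseteq> S\<close> of \<open>f V\<close> times the product of \<open>g\<close> over the
  gaps that \<open>V\<close> leaves in \<open>S\<close>. This operation is linear in \<open>f\<close> and associative (\<open>gap_comp_assoc\<close>);
  \<open>closed_comp\<close> is its variant in which \<open>V\<close> contains both ends of \<open>S\<close>.

  The hook formula for forests turns \<open>t(\<pi>)!\<close> into the product over the blocks of \<open>\<pi>\<close> of the number of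
  blocks weakly below them (\<open>forest_fact_eq_prod_hook\<close>). Put
  \<open>\<Psi>(s, S) = (\<Sum>\<pi>. s ^ |\<pi>| / t(\<pi>)! * \<Prod>V. h' V)\<close>, a polynomial in \<open>s\<close>; here \<open>\<Psi>(0)\<close> is the
  indicator of the empty set, the left unit of \<open>gap_comp\<close>, and \<open>\<Psi>(1)\<close> gives the moments of \<open>\<psi>\<close>.
  Since \<open>|\<pi>|\<close> is the sum of the hooks of the outer blocks, differentiating in \<open>s\<close> amounts to
  removing one outer block, and what remains is an arbitrary non-crossing partition of each of its
  gaps: \<open>d\<Psi>/ds = gap_comp h' \<Psi>\<close>, where \<open>h'\<close> is set to zero at the empty set. Hence the
  right-hand side at \<open>S\<close> sees \<open>\<Psi>\<close> on proper subsets of \<open>S\<close> only, so associativity and induction on \<open>|S|\<close> show that \<open>\<Psi>\<close> is a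
  flow, \<open>gap_comp \<Psi>(s) \<Psi>(t) = \<Psi>(s + t)\<close> (\<open>gap_comp_flow\<close>).

  Let \<open>J(s, S)\<close> be the same sum over irreducible partitions with \<open>hc\<close> on the outer block. Then
  \<open>dJ/ds = closed_comp hc \<Psi>(s)\<close>, and the flow property gives the cocycle identity
  \<open>J(s + t) = closed_comp J(s) \<Psi>(t) + J(t)\<close> (\<open>irr_flow_add\<close>). At \<open>s = -1\<close>, \<open>t = 1\<close> it reads
  \<open>J(1) = closed_comp (- J(-1)) \<Psi>(1)\<close>.

  The functional \<open>\<phi>\<close> determines the sums over irreducible partitions, its Boolean cumulants
  (\<open>irr_sum_unique\<close>). Computed from the c-monotone cumulants they are \<open>J(1)\<close>; computed from the c-free
  ones they are \<open>closed_comp kc \<Psi>(1)\<close>, because the free cumulants of the blocks lying in a gap sum up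
  to the moment of that gap. As \<open>\<Psi>(1)\<close> is \<open>1\<close> on the empty set, \<open>closed_comp\<close> with \<open>\<Psi>(1)\<close> is
  unitriangular with respect to inclusion, hence injective (\<open>closed_comp_cancel\<close>). Therefore
  \<open>kc = - J(-1)\<close>, which is the asserted formula.
\<close>

section \<open>Composition through gaps\<close>

text \<open>The first factor runs over the elements of \<open>V\<close> and takes the gap immediately before each of
  them, including the initial one; the last factor is the gap after the end of \<open>V\<close>.\<close>

definition gap_product :: "(nat set \<Rightarrow> complex) \<Rightarrow> nat set \<Rightarrow> nat set \<Rightarrow> complex" where
  "gap_product g S V =
     (\<Prod>v\<in>V. g {x\<in>S. x < v \<and> (\<forall>u\<in>V. u < v \<longrightarrow> u < x)}) * g {x\<in>S. \<forall>u\<in>V. u < x}"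

definition gap_comp :: "(nat set \<Rightarrow> complex) \<Rightarrow> (nat set \<Rightarrow> complex) \<Rightarrow> nat set \<Rightarrow> complex" where
  "gap_comp f g S = (\<Sum>V\<in>Pow S. f V * gap_product g S V)"

lemma gap_product_empty [simp]: "gap_product g S {} = g S"
  by (simp add: gap_product_def)

text \<open>An element of \<open>V\<close> cuts both \<open>S\<close> and \<open>V\<close>, and no gap reaches across it. All recursions for gap
  products come from this.\<close>

lemma gap_product_split:
  assumes "finite V" "b \<in> V"
  shows "gap_product g S V =
    gap_product g (S \<inter> {..<b}) (V \<inter> {..<b}) * gap_product g (S \<inter> {b<..}) (V \<inter> {b<..})"
proof -
  let ?G = "\<lambda>v. g {x\<in>S. x < v \<and> (\<forall>u\<in>V. u < v \<longrightarrow> u < x)}"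
  have V: "V = (V \<inter> {..<b}) \<union> insert b (V \<inter> {b<..})"
    using assms(2) by auto
  have "prod ?G V = prod ?G (V \<inter> {..<b}) * prod ?G (insert b (V \<inter> {b<..}))"
    by (subst V, rule prod.union_disjoint) (use assms(1) in auto)
  also have "prod ?G (insert b (V \<inter> {b<..})) = ?G b * prod ?G (V \<inter> {b<..})"
    using assms(1) by simp
  also have "?G b = g {x \<in> S \<inter> {..<b}. \<forall>u\<in>V \<inter> {..<b}. u < x}"
    by (rule arg_cong[where f = g]) auto
  also have "prod ?G (V \<inter> {..<b}) = (\<Prod>v\<in>V \<inter> {..<b}. g {x \<in> S \<inter> {..<b}. x < v \<and>
      (\<forall>u\<in>V \<inter> {..<b}. u < v \<longrightarrow> u < x)})"
    by (intro prod.cong refl arg_cong[where f = g]) auto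
  also have "prod ?G (V \<inter> {b<..}) = (\<Prod>v\<in>V \<inter> {b<..}. g {x \<in> S \<inter> {b<..}. x < v \<and>
      (\<forall>u\<in>V \<inter> {b<..}. u < v \<longrightarrow> u < x)})"
    using assms(2) by (intro prod.cong refl arg_cong[where f = g])
      (auto; metis linorder_neqE_nat order.strict_trans)
  moreover have "{x\<in>S. \<forall>u\<in>V. u < x} = {x \<in> S \<inter> {b<..}. \<forall>u\<in>V \<inter> {b<..}. u < x}"
    using assms(2) by (auto; metis linorder_neqE_nat order.strict_trans)
  ultimately show ?thesis
    by (simp add: gap_product_def mult_ac)
qed

text \<open>A gap of a nonempty \<open>V\<close> misses the elements of \<open>V\<close>, so it is a proper subset of \<open>S\<close>. This is what
  makes inductions on \<open>card S\<close> work.\<close>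

lemma gap_product_cong:
  assumes "V \<subseteq> S" "V \<noteq> {}" "\<And>T. T \<subset> S \<Longrightarrow> g T = g' T"
  shows "gap_product g S V = gap_product g' S V"
proof -
  obtain v where v: "v \<in> V" using assms(2) by blast
  have "g {x\<in>S. x < v \<and> (\<forall>u\<in>V. u < v \<longrightarrow> u < x)} = g' {x\<in>S. x < v \<and> (\<forall>u\<in>V. u < v \<longrightarrow> u < x)}"
    if "v \<in> V" for v
    using that assms(1) by (intro assms(3)) auto
  moreover have "g {x\<in>S. \<forall>u\<in>V. u < x} = g' {x\<in>S. \<forall>u\<in>V. u < x}"
    using v assms(1) by (intro assms(3)) auto
  ultimately show ?thesis by (simp add: gap_product_def)
qed

lemma gap_comp_cong_left:
  assumes "\<And>V. V \<subseteq> S \<Longrightarrow> f V = f' V"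
  shows "gap_comp f g S = gap_comp f' g S"
  unfolding gap_comp_def using assms by (intro sum.cong) auto

lemma gap_comp_cong_right:
  assumes "f {} = 0" "\<And>T. T \<subset> S \<Longrightarrow> g T = g' T"
  shows "gap_comp f g S = gap_comp f g' S"
  unfolding gap_comp_def
proof (rule sum.cong[OF refl])
  fix V assume "V \<in> Pow S"
  then show "f V * gap_product g S V = f V * gap_product g' S V"
    using assms gap_product_cong[of V S g g'] by (cases "V = {}") auto
qed

lemma gap_comp_add_left: "gap_comp (\<lambda>V. f V + f' V) g S = gap_comp f g S + gap_comp f' g S"
  by (simp add: gap_comp_def distrib_right sum.distrib)

lemma gap_comp_mult_left: "gap_comp (\<lambda>V. c * f V) g S = c * gap_comp f g S"
  by (simp add: gap_comp_def sum_distrib_left mult.assoc)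

lemma gap_comp_unit_left:
  assumes "finite S" shows "gap_comp (\<lambda>V. if V = {} then c else 0) g S = c * g S"
proof -
  have "gap_comp (\<lambda>V. if V = {} then c else 0) g S =
      (\<Sum>V\<in>Pow S. if V = {} then c * gap_product g S V else 0)"
    unfolding gap_comp_def by (intro sum.cong) auto
  also have "\<dots> = c * g S"
    using assms by (simp add: sum.delta')
  finally show ?thesis .
qed

text \<open>A Leibniz rule: if the left argument is a sum over the points \<open>b\<close> at which \<open>V\<close> can be cut, of
  products of a function of the part before \<open>b\<close> and one of the part after \<open>b\<close>, then composing on the
  right acts on the two factors separately. A cut \<open>b\<close> of some \<open>V \<subseteq> S\<close> is the same as a cut of \<open>S\<close>
  together with a subset of either side.\<close>

lemma gap_comp_split:
  assumes "finite S"
  shows "gap_comp (\<lambda>V. \<Sum>b\<in>V. p b (V \<inter> {..<b}) * q b (V \<inter> {b<..})) g S =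
    (\<Sum>b\<in>S. gap_comp (p b) g (S \<inter> {..<b}) * gap_comp (q b) g (S \<inter> {b<..}))"
proof -
  have fin: "finite V" if "V \<subseteq> S" for V using that assms by (rule finite_subset)
  let ?w = "\<lambda>b U W. p b U * gap_product g (S \<inter> {..<b}) U * (q b W * gap_product g (S \<inter> {b<..}) W)"
  have "gap_comp (\<lambda>V. \<Sum>b\<in>V. p b (V \<inter> {..<b}) * q b (V \<inter> {b<..})) g S =
      (\<Sum>V\<in>Pow S. \<Sum>b\<in>V. ?w b (V \<inter> {..<b}) (V \<inter> {b<..}))"
    unfolding gap_comp_def
  proof (intro sum.cong refl)
    fix V assume "V \<in> Pow S"
    then show "(\<Sum>b\<in>V. p b (V \<inter> {..<b}) * q b (V \<inter> {b<..})) * gap_product g S V =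
        (\<Sum>b\<in>V. ?w b (V \<inter> {..<b}) (V \<inter> {b<..}))"
      unfolding sum_distrib_right
      by (intro sum.cong refl) (simp add: gap_product_split[OF fin, where S = S] mult_ac)
  qed
  also have "\<dots> = (\<Sum>(V, b)\<in>(SIGMA V:Pow S. V). ?w b (V \<inter> {..<b}) (V \<inter> {b<..}))"
    using assms fin by (subst sum.Sigma) auto
  also have "\<dots> = (\<Sum>(b, U, W)\<in>(SIGMA b:S. Pow (S \<inter> {..<b}) \<times> Pow (S \<inter> {b<..})). ?w b U W)"
    by (rule sum.reindex_bij_witness[where i = "\<lambda>(b, U, W). (U \<union> insert b W, b)"
          and j = "\<lambda>(V, b). (b, V \<inter> {..<b}, V \<inter> {b<..})"]) auto
  also have "\<dots> = (\<Sum>b\<in>S. \<Sum>(U, W)\<in>Pow (S \<inter> {..<b}) \<times> Pow (S \<inter> {b<..}). ?w b U W)"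
    using assms by (subst sum.Sigma) auto
  also have "\<dots> = (\<Sum>b\<in>S. gap_comp (p b) g (S \<inter> {..<b}) * gap_comp (q b) g (S \<inter> {b<..}))"
    unfolding gap_comp_def sum_product
    by (intro sum.cong refl) (simp add: sum.cartesian_product)
  finally show ?thesis .
qed

text \<open>The recursion that chooses the smallest element \<open>b\<close> of \<open>V\<close> first: the part of \<open>S\<close> before \<open>b\<close> is a
  gap, the rest of \<open>V\<close> is chosen behind \<open>b\<close>. It is an instance of \<open>gap_comp_split\<close>, because cutting
  \<open>V\<close> with the factor that vanishes unless the part before \<open>b\<close> is empty singles out \<open>b = Min V\<close>.\<close>

lemma gap_comp_rec:
  assumes "finite S"
  shows "gap_comp f g S = f {} * g S +
    (\<Sum>b\<in>S. g (S \<inter> {..<b}) * gap_comp (\<lambda>U. f (insert b U)) g (S \<inter> {b<..}))"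
proof -
  \<comment> \<open>\<open>?\<epsilon> 1\<close> is the left unit of \<open>gap_comp\<close>\<close>
  let ?\<epsilon> = "\<lambda>c V::nat set. if V = {} then c else (0::complex)"
  have f: "f V = ?\<epsilon> (f {}) V + (\<Sum>b\<in>V. ?\<epsilon> 1 (V \<inter> {..<b}) * f (insert b (V \<inter> {b<..})))"
    if "V \<subseteq> S" for V
  proof (cases "V = {}")
    case False
    have fin: "finite V" using that assms by (rule finite_subset)
    have *: "V \<inter> {..<b} = {} \<longleftrightarrow> b = Min V" if "b \<in> V" for b
    proof
      assume "V \<inter> {..<b} = {}"
      then show "b = Min V"
        using that fin by (intro Min_eqI[symmetric]) (auto simp: not_less[symmetric])
    qed (use fin in \<open>auto simp: not_le[symmetric]\<close>)
    have "(\<Sum>b\<in>V. ?\<epsilon> 1 (V \<inter> {..<b}) * f (insert b (V \<inter> {b<..}))) =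
        (\<Sum>b\<in>V. if b = Min V then f (insert b (V \<inter> {b<..})) else 0)"
      by (intro sum.cong refl) (simp add: *)
    also have "\<dots> = f (insert (Min V) (V \<inter> {Min V<..}))"
      using fin False by simp
    also have "insert (Min V) (V \<inter> {Min V<..}) = V"
      using Min_in[OF fin False] Min_le[OF fin] by (fastforce simp del: Min_in simp: order.strict_iff_order)
    finally show ?thesis using False by simp
  qed simp
  have "gap_comp f g S = gap_comp (\<lambda>V. ?\<epsilon> (f {}) V +
      (\<Sum>b\<in>V. ?\<epsilon> 1 (V \<inter> {..<b}) * f (insert b (V \<inter> {b<..})))) g S"
    by (rule gap_comp_cong_left) (rule f)
  also have "\<dots> = f {} * g S +
      (\<Sum>b\<in>S. g (S \<inter> {..<b}) * gap_comp (\<lambda>U. f (insert b U)) g (S \<inter> {b<..}))"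
    using assms by (simp add: gap_comp_add_left gap_comp_unit_left
        gap_comp_split[where p = "\<lambda>b. ?\<epsilon> 1" and q = "\<lambda>b U. f (insert b U)"])
  finally show ?thesis .
qed

text \<open>Expand the inner composition by \<open>gap_comp_rec\<close>; by \<open>gap_comp_split\<close> the outer composition turns
  the first gap into \<open>gap_comp g h\<close>, and the part behind \<open>b\<close> is covered by the induction hypothesis.\<close>

lemma gap_comp_assoc:
  assumes "finite S"
  shows "gap_comp (gap_comp f g) h S = gap_comp f (gap_comp g h) S"
  using assms
proof (induction "card S" arbitrary: S f rule: less_induct)
  case less
  have fin: "finite V" if "V \<subseteq> S" for V using that less.prems by (rule finite_subset)
  have "gap_comp (gap_comp f g) h S = gap_comp (\<lambda>V. f {} * g V +
      (\<Sum>b\<in>V. g (V \<inter> {..<b}) * gap_comp (\<lambda>U. f (insert b U)) g (V \<inter> {b<..}))) h S"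
    by (rule gap_comp_cong_left) (simp add: gap_comp_rec fin)
  also have "\<dots> = f {} * gap_comp g h S + (\<Sum>b\<in>S. gap_comp g h (S \<inter> {..<b}) *
      gap_comp (gap_comp (\<lambda>U. f (insert b U)) g) h (S \<inter> {b<..}))"
    using less.prems by (simp add: gap_comp_add_left gap_comp_mult_left
        gap_comp_split[where p = "\<lambda>b. g" and q = "\<lambda>b. gap_comp (\<lambda>U. f (insert b U)) g"])
  also have "\<dots> = f {} * gap_comp g h S + (\<Sum>b\<in>S. gap_comp g h (S \<inter> {..<b}) *
      gap_comp (\<lambda>U. f (insert b U)) (gap_comp g h) (S \<inter> {b<..}))"
  proof (intro arg_cong2[where f = "(+)"] refl sum.cong arg_cong2[where f = "(*)"])
    fix b assume b: "b \<in> S"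
    have "card (S \<inter> {b<..}) < card S"
      using b by (intro psubset_card_mono less.prems) auto
    then show "gap_comp (gap_comp (\<lambda>U. f (insert b U)) g) h (S \<inter> {b<..}) =
        gap_comp (\<lambda>U. f (insert b U)) (gap_comp g h) (S \<inter> {b<..})"
      by (rule less.hyps) (simp add: less.prems)
  qed
  also have "\<dots> = gap_comp f (gap_comp g h) S"
    using less.prems by (rule gap_comp_rec[symmetric])
  finally show ?case .
qed

definition closed_comp :: "(nat set \<Rightarrow> complex) \<Rightarrow> (nat set \<Rightarrow> complex) \<Rightarrow> nat set \<Rightarrow> complex" where
  "closed_comp f g S = gap_comp (\<lambda>V. if Min S \<in> V \<and> Max S \<in> V then f V else 0) g S"

lemma closed_comp_eq_sum:
  assumes "finite S"
  shows "closed_comp f g S = (\<Sum>V\<in>{V\<in>Pow S. Min S \<in> V \<and> Max S \<in> V}. f V * gap_product g S V)"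
  unfolding closed_comp_def gap_comp_def using assms
  by (intro sum.mono_neutral_cong_right) auto

lemma closed_comp_cong_right:
  assumes "finite S" "\<And>T. finite T \<Longrightarrow> g T = g' T"
  shows "closed_comp f g S = closed_comp f g' S"
  using assms unfolding closed_comp_def gap_comp_def gap_product_def
  by (intro sum.cong refl arg_cong2[where f = "(*)"] prod.cong) auto

text \<open>A subset of \<open>S\<close> containing both ends of \<open>S\<close> has the same ends as \<open>S\<close>, so for fixed \<open>S\<close> the closed
  composition is \<open>gap_comp\<close> with a modified left argument, and associativity carries over.\<close>

lemma closed_comp_assoc:
  assumes "finite S"
  shows "closed_comp (closed_comp f g) h S = closed_comp f (gap_comp g h) S"
proof -
  let ?f = "\<lambda>V. if Min S \<in> V \<and> Max S \<in> V then f V else 0"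
  have "(if Min S \<in> V \<and> Max S \<in> V then closed_comp f g V else 0) = gap_comp ?f g V" if "V \<subseteq> S" for V
  proof (cases "Min S \<in> V \<and> Max S \<in> V")
    case True
    have "finite V" using assms that finite_subset by blast
    then have "Min V = Min S" "Max V = Max S"
      using True that assms by (auto intro!: Min_eqI Max_eqI)
    then show ?thesis using True by (simp add: closed_comp_def)
  next
    case False
    then have "gap_comp ?f g V = 0" unfolding gap_comp_def by (intro sum.neutral) auto
    then show ?thesis using False by auto
  qed
  then show ?thesis
    unfolding gap_comp_assoc[OF assms, symmetric] closed_comp_def[of f "gap_comp g h"]
      closed_comp_def[of "closed_comp f g"]
    by (rule gap_comp_cong_left)
qed

lemma gap_product_self:
  assumes "g {} = 1"
  shows "gap_product g S S = 1"
proof -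
  have "{x\<in>S. x < v \<and> (\<forall>u\<in>S. u < v \<longrightarrow> u < x)} = {}" for v by auto
  moreover have "{x\<in>S. \<forall>u\<in>S. u < x} = {}" by auto
  ultimately show ?thesis unfolding gap_product_def using assms by (simp only: prod.neutral_const mult_1)
qed

text \<open>The term \<open>V = S\<close> contributes \<open>f S\<close> itself, all other terms involve smaller sets.\<close>

lemma closed_comp_cancel:
  assumes "g {} = 1"
    and "\<And>S. finite S \<Longrightarrow> S \<noteq> {} \<Longrightarrow> closed_comp f g S = closed_comp f' g S"
  shows "finite S \<Longrightarrow> S \<noteq> {} \<Longrightarrow> f S = f' S"
proof (induction "card S" arbitrary: S rule: less_induct)
  case less
  let ?E = "{V\<in>Pow S. Min S \<in> V \<and> Max S \<in> V}"
  have E: "finite ?E" "S \<in> ?E" using less.prems by auto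
  have dec: "closed_comp f g S = f S + (\<Sum>V\<in>?E - {S}. f V * gap_product g S V)" for f
    unfolding closed_comp_eq_sum[OF less.prems(1)]
    by (subst sum.remove[OF E]) (simp add: gap_product_self assms(1))
  have "(\<Sum>V\<in>?E - {S}. f V * gap_product g S V) = (\<Sum>V\<in>?E - {S}. f' V * gap_product g S V)"
  proof (rule sum.cong[OF refl])
    fix V assume V: "V \<in> ?E - {S}"
    then have "card V < card S" using less.prems(1) by (intro psubset_card_mono) auto
    moreover have "finite V" "V \<noteq> {}" using V less.prems(1) finite_subset by auto
    ultimately show "f V * gap_product g S V = f' V * gap_product g S V"
      using less.hyps by simp
  qed
  then show ?case using dec[of f] dec[of f'] assms(2)[OF less.prems] by simp
qed

section \<open>Nesting in non-crossing partitions of finite sets\<close>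

definition NC_on :: "nat set \<Rightarrow> nat set set set" where
  "NC_on S = {\<pi>. partition_on S \<pi> \<and> noncrossing \<pi>}"

text \<open>Non-crossing blocks are compared through single points: for distinct blocks it suffices that one
  point of \<open>W\<close> lies between two points of \<open>V\<close> for \<open>W\<close> to be nested in \<open>V\<close> (\<open>straddles_imp_nests\<close>).\<close>

definition straddles :: "nat set \<Rightarrow> nat \<Rightarrow> bool" where
  "straddles W v \<longleftrightarrow> (\<exists>x\<in>W. \<exists>z\<in>W. x < v \<and> v < z)"

lemma NC_onD:
  assumes "\<pi> \<in> NC_on S"
  shows "partition_on S \<pi>" "noncrossing \<pi>"
  using assms by (auto simp: NC_on_def)

lemma finite_NC_on: "finite S \<Longrightarrow> finite (NC_on S)"
  by (rule finite_subset[OF _ finitely_many_partition_on[of S]]) (auto simp: NC_on_def)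

lemma NC_on_finite: "finite S \<Longrightarrow> \<pi> \<in> NC_on S \<Longrightarrow> finite \<pi>"
  using NC_onD(1) finite_elements by blast

lemma NC_on_empty: "NC_on {} = {{}}"
  by (auto simp: NC_on_def partition_on_empty noncrossing_def)

lemma NC_on_block:
  assumes "\<pi> \<in> NC_on S" "V \<in> \<pi>"
  shows "V \<subseteq> S" "V \<noteq> {}"
  using NC_onD(1)[OF assms(1)] assms(2) by (auto simp: partition_on_def)

lemma NC_on_disjoint:
  assumes "\<pi> \<in> NC_on S" "V \<in> \<pi>" "W \<in> \<pi>" "x \<in> V" "x \<in> W"
  shows "V = W"
  using NC_onD(1)[OF assms(1)] assms by (auto simp: partition_on_def disjoint_def)

lemma NC_on_noncross:
  assumes "\<pi> \<in> NC_on S" "V \<in> \<pi>" "W \<in> \<pi>" "V \<noteq> W"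
    "a < b" "b < c" "c < d" "a \<in> V" "c \<in> V" "b \<in> W" "d \<in> W"
  shows False
proof -
  have "\<not> (\<exists>a b c d. a < b \<and> b < c \<and> c < d \<and> a \<in> V \<and> c \<in> V \<and> b \<in> W \<and> d \<in> W)"
    using NC_onD(2)[OF assms(1), unfolded noncrossing_def] assms(2-4) by (elim ballE impE) auto
  then show False using assms(5-) by metis
qed

lemma nests_irrefl: "\<not> nests V V"
  unfolding nests_def by blast

lemma nests_trans:
  assumes "nests U V" "nests V W"
  shows "nests U W"
  using assms unfolding nests_def by (meson order.strict_trans)

lemma nests_straddles: "nests V W \<Longrightarrow> w \<in> W \<Longrightarrow> straddles V w"
  unfolding nests_def straddles_def by blast

lemma straddles_imp_nests:
  assumes "\<pi> \<in> NC_on S" "V \<in> \<pi>" "W \<in> \<pi>" "V \<noteq> W" "w \<in> W" "straddles V w"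
  shows "nests V W"
proof -
  obtain a b where ab: "a \<in> V" "b \<in> V" "a < w" "w < b"
    using assms(6) unfolding straddles_def by blast
  have "a < u \<and> u < b" if u: "u \<in> W" for u
  proof -
    have "u \<noteq> a" "u \<noteq> b" using NC_on_disjoint[OF assms(1-3)] u ab assms(4) by auto
    then show ?thesis
      using NC_on_noncross[OF assms(1) assms(3,2), of u a w b]
        NC_on_noncross[OF assms(1) assms(2,3), of a w b u] assms(4,5) ab u
      by (metis linorder_neqE_nat)
  qed
  then show ?thesis using ab unfolding nests_def by blast
qed

text \<open>The blocks in which a given block is nested form a chain, so the nesting order is a forest. If both
  \<open>U\<close> and \<open>V\<close> surround \<open>w \<in> W\<close>, the one whose element before \<open>w\<close> comes first straddles that element
  of the other.\<close>

lemma nests_comparable: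
  assumes "\<pi> \<in> NC_on S" "U \<in> \<pi>" "V \<in> \<pi>" "W \<in> \<pi>" "nests U W" "nests V W" "U \<noteq> V"
  shows "nests U V \<or> nests V U"
proof -
  have *: "nests U V" if UV: "U \<in> \<pi>" "V \<in> \<pi>" "U \<noteq> V" "a \<in> U" "b \<in> U" "a' \<in> V" "b' \<in> V"
      "a < a'" "a' < w" "w < b" "w < b'" for U V a b a' b' w
    using straddles_imp_nests[OF assms(1) UV(1-3) UV(6)] that unfolding straddles_def
    by (meson order.strict_trans)
  obtain w where w: "w \<in> W" using NC_on_block(2)[OF assms(1,4)] by blast
  obtain a b where ab: "a \<in> U" "b \<in> U" "a < w" "w < b" using assms(5) w unfolding nests_def by blast
  obtain a' b' where ab': "a' \<in> V" "b' \<in> V" "a' < w" "w < b'"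
    using assms(6) w unfolding nests_def by blast
  have "a \<noteq> a'" using NC_on_disjoint[OF assms(1-3)] ab ab' assms(7) by auto
  then consider "a < a'" | "a' < a" by linarith
  then show ?thesis
  proof cases
    case 1 then show ?thesis using *[of U V a b a' b' w] ab ab' assms by blast
  next
    case 2 then show ?thesis using *[of V U a' b' a b w] ab ab' assms by blast
  qed
qed

section \<open>Forest factorials as hook products\<close>

definition below :: "nat set set \<Rightarrow> nat set \<Rightarrow> nat set set" where
  "below \<pi> V = {W \<in> \<pi>. W = V \<or> nests V W}"

definition hook :: "nat set set \<Rightarrow> nat set \<Rightarrow> nat" where
  "hook \<pi> V = card (below \<pi> V)"

lemma below_child_subset: "W \<in> child_blocks \<pi> V \<Longrightarrow> below \<pi> W \<subseteq> below \<pi> V"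
  unfolding below_def child_blocks_def using nests_trans by blast

text \<open>Used with \<open>P\<close> trivial to find the outer block above \<open>W\<close>, and with \<open>P\<close> meaning "nested in \<open>V\<close>" to
  find the child of \<open>V\<close> above \<open>W\<close>.\<close>

lemma exists_maximal_above:
  assumes "finite \<pi>" "W \<in> \<pi>" "P W" 
  shows "\<exists>V\<in>\<pi>. P V \<and> W \<in> below \<pi> V \<and> \<not> (\<exists>U\<in>\<pi>. P U \<and> nests U V)"
proof -
  let ?A = "{V \<in> \<pi>. P V \<and> W \<in> below \<pi> V}"
  have "finite ?A" "?A \<noteq> {}" using assms by (auto simp: below_def)
  then obtain V where V: "V \<in> ?A" "\<And>U. U \<in> ?A \<Longrightarrow> card (below \<pi> U) \<le> card (below \<pi> V)"
    using obtains_MAX[of ?A "\<lambda>U. card (below \<pi> U)"] by (metis (no_types, lifting) Max_ge finite_imageI imageI)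
  have "\<not> (P U \<and> nests U V)" if U: "U \<in> \<pi>" for U
  proof
    assume "P U \<and> nests U V"
    then have U': "P U" "nests U V" by auto
    have "below \<pi> V \<subseteq> below \<pi> U"
      using U'(2) nests_trans[of U V] by (auto simp: below_def)
    moreover have "U \<in> below \<pi> U" "U \<notin> below \<pi> V"
      using U U'(2) nests_trans[of U V U] nests_irrefl by (auto simp: below_def)
    ultimately have "below \<pi> V \<subset> below \<pi> U" by blast
    moreover from this have "U \<in> ?A" using U U'(1) V(1) by blast
    ultimately show False
      using V(2)[of U] assms(1) psubset_card_mono[of "below \<pi> U" "below \<pi> V"]
      by (simp add: below_def)
  qed
  then show ?thesis using V(1) by blast
qed

lemma below_disjoint:
  assumes "\<pi> \<in> NC_on S" "V \<in> \<pi>" "V' \<in> \<pi>" "V \<noteq> V'" "\<not> nests V V'" "\<not> nests V' V"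
  shows "below \<pi> V \<inter> below \<pi> V' = {}"
  using nests_comparable[OF assms(1-3)] assms(4-) unfolding below_def by blast

lemma outer_blocks_subset: "outer_blocks \<pi> \<subseteq> \<pi>"
  by (auto simp: outer_blocks_def)

lemma UN_below_outer:
  assumes "finite \<pi>"
  shows "(\<Union>V\<in>outer_blocks \<pi>. below \<pi> V) = \<pi>"
proof
  show "\<pi> \<subseteq> (\<Union>V\<in>outer_blocks \<pi>. below \<pi> V)"
    using exists_maximal_above[OF assms, of _ "\<lambda>_. True"] unfolding outer_blocks_def by fast
qed (auto simp: below_def outer_blocks_def)

lemma below_outer_disjoint:
  assumes "\<pi> \<in> NC_on S" "V \<in> outer_blocks \<pi>" "V' \<in> outer_blocks \<pi>" "V \<noteq> V'"
  shows "below \<pi> V \<inter> below \<pi> V' = {}"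
  using assms by (intro below_disjoint[OF assms(1)]) (auto simp: outer_blocks_def)

text \<open>Together with the disjointness of the sets below different children this is the tree structure
  underlying the recursion of \<open>tree_size\<close> and \<open>tree_fact\<close>.\<close>

lemma below_decompose:
  assumes "finite \<pi>" "V \<in> \<pi>"
  shows "below \<pi> V = insert V (\<Union>W\<in>child_blocks \<pi> V. below \<pi> W)"
proof
  show "below \<pi> V \<subseteq> insert V (\<Union>W\<in>child_blocks \<pi> V. below \<pi> W)"
    using exists_maximal_above[OF assms(1), of _ "nests V"]
    unfolding below_def child_blocks_def by fastforce
qed (use assms below_child_subset in \<open>auto simp: below_def\<close>)

lemma below_child_disjoint:
  assumes "\<pi> \<in> NC_on S" "W \<in> child_blocks \<pi> V" "W' \<in> child_blocks \<pi> V" "W \<noteq> W'"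
  shows "below \<pi> W \<inter> below \<pi> W' = {}"
  using assms by (intro below_disjoint[OF assms(1)]) (auto simp: child_blocks_def)

lemma not_in_below_child: "W \<in> child_blocks \<pi> V \<Longrightarrow> V \<notin> below \<pi> W"
  using nests_irrefl nests_trans unfolding below_def child_blocks_def by blast

lemma hook_below_recursion:
  assumes "\<pi> \<in> NC_on S" "finite S" "V \<in> \<pi>"
  shows "hook \<pi> V = 1 + (\<Sum>W\<in>child_blocks \<pi> V. hook \<pi> W)" (is ?A)
    and "(\<Prod>U\<in>below \<pi> V. hook \<pi> U) =
      hook \<pi> V * (\<Prod>W\<in>child_blocks \<pi> V. \<Prod>U\<in>below \<pi> W. hook \<pi> U)" (is ?B)
proof -
  have fin: "finite \<pi>" using assms NC_on_finite by blast
  have fin_below: "finite (below \<pi> W)" for W using fin by (simp add: below_def)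
  have fin_child: "finite (child_blocks \<pi> V)" using fin by (simp add: child_blocks_def)
  note dec = below_decompose[OF fin assms(3)]
  have notin: "V \<notin> (\<Union>W\<in>child_blocks \<pi> V. below \<pi> W)" using not_in_below_child by blast
  have disj: "\<forall>i\<in>child_blocks \<pi> V. \<forall>j\<in>child_blocks \<pi> V. i \<noteq> j \<longrightarrow> below \<pi> i \<inter> below \<pi> j = {}"
    using below_child_disjoint[OF assms(1)] by blast
  have "card (\<Union>W\<in>child_blocks \<pi> V. below \<pi> W) = (\<Sum>W\<in>child_blocks \<pi> V. hook \<pi> W)"
    unfolding hook_def using fin_below fin_child disj by (intro card_UN_disjoint) auto
  then show ?A
    unfolding hook_def using notin fin_below fin_child by (subst dec) simp
  have "(\<Prod>U\<in>(\<Union>W\<in>child_blocks \<pi> V. below \<pi> W). hook \<pi> U) =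
      (\<Prod>W\<in>child_blocks \<pi> V. \<Prod>U\<in>below \<pi> W. hook \<pi> U)"
    using fin_below fin_child disj by (intro prod.UNION_disjoint) auto
  then show ?B
    using notin fin_below fin_child by (subst dec) simp
qed

lemma nesting_tree_hooks:
  assumes "\<pi> \<in> NC_on S" "finite S" "V \<in> \<pi>"
  shows "tree_size (nesting_tree \<pi> V) = hook \<pi> V
    \<and> tree_fact (nesting_tree \<pi> V) = (\<Prod>U\<in>below \<pi> V. hook \<pi> U)"
  using assms
proof (induction \<pi> V rule: nesting_tree.induct)
  case (1 \<pi> V)
  have fin: "finite (child_blocks \<pi> V)"
    using 1 NC_on_finite[of S \<pi>] by (simp add: child_blocks_def)
  have IH: "tree_size (nesting_tree \<pi> W) = hook \<pi> W"
    "tree_fact (nesting_tree \<pi> W) = (\<Prod>U\<in>below \<pi> W. hook \<pi> U)" if "W \<in> child_blocks \<pi> V" for W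
    using 1 that fin by (auto simp: child_blocks_def)
  have size: "tree_size (nesting_tree \<pi> V) = hook \<pi> V"
    unfolding hook_below_recursion(1)[OF 1(2-4)]
    by (subst nesting_tree.simps)
      (simp add: multiset.map_comp comp_def IH flip: sum_unfold_sum_mset)
  moreover have "tree_fact (nesting_tree \<pi> V) = (\<Prod>U\<in>below \<pi> V. hook \<pi> U)"
    unfolding hook_below_recursion(2)[OF 1(2-4)] size[symmetric]
    by (subst (1 2) nesting_tree.simps)
      (simp add: multiset.map_comp comp_def IH flip: prod_unfold_prod_mset)
  ultimately show ?case by simp
qed

text \<open>The hook formula: unrolling the tree factorial, every block contributes the size of its subtree
  exactly once. It replaces trees by a product over blocks, which is easy to restrict and relabel.\<close>

lemma forest_fact_eq_prod_hook:
  assumes "\<pi> \<in> NC_on S" "finite S"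
  shows "forest_fact (nesting_forest \<pi>) = (\<Prod>V\<in>\<pi>. hook \<pi> V)"
proof -
  have fin: "finite \<pi>" using assms NC_on_finite by blast
  have "forest_fact (nesting_forest \<pi>) = (\<Prod>V\<in>outer_blocks \<pi>. tree_fact (nesting_tree \<pi> V))"
    by (simp add: forest_fact_def nesting_forest_def multiset.map_comp comp_def
        flip: prod_unfold_prod_mset)
  also have "\<dots> = (\<Prod>V\<in>outer_blocks \<pi>. \<Prod>U\<in>below \<pi> V. hook \<pi> U)"
    using nesting_tree_hooks[OF assms] outer_blocks_subset by (intro prod.cong) auto
  also have "\<dots> = (\<Prod>U\<in>(\<Union>V\<in>outer_blocks \<pi>. below \<pi> V). hook \<pi> U)"
    using below_outer_disjoint[OF assms(1)] fin finite_subset[OF outer_blocks_subset fin]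
    by (intro prod.UNION_disjoint[symmetric]) (auto simp: below_def)
  finally show ?thesis using UN_below_outer[OF fin] by simp
qed

text \<open>Every block lies weakly below exactly one outer block. This produces the removal of an outer
  block from the factor \<open>card \<pi>\<close> in a derivative.\<close>

lemma card_eq_sum_hook:
  assumes "\<pi> \<in> NC_on S" "finite S"
  shows "card \<pi> = (\<Sum>V\<in>outer_blocks \<pi>. hook \<pi> V)"
proof -
  have fin: "finite \<pi>" using assms NC_on_finite by blast
  have "card (\<Union>V\<in>outer_blocks \<pi>. below \<pi> V) = (\<Sum>V\<in>outer_blocks \<pi>. hook \<pi> V)"
    unfolding hook_def
    using below_outer_disjoint[OF assms(1)] fin finite_subset[OF outer_blocks_subset fin]
    by (intro card_UN_disjoint) (auto simp: below_def)
  then show ?thesis using UN_below_outer[OF fin] by simp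
qed

lemma hook_pos: "finite \<pi> \<Longrightarrow> V \<in> \<pi> \<Longrightarrow> hook \<pi> V > 0"
  by (auto simp: hook_def below_def card_gt_0_iff)

section \<open>Weighted sums over non-crossing partitions\<close>

text \<open>The non-crossing configurations that can be put into the gaps of \<open>V\<close>; adding \<open>V\<close> as a block makes it
  outer.\<close>

definition NC_gaps :: "nat set \<Rightarrow> nat set \<Rightarrow> nat set set set" where
  "NC_gaps S V = {\<rho> \<in> NC_on (S - V). \<forall>W\<in>\<rho>. \<forall>v\<in>V. \<not> straddles W v}"

definition NC_irr_on :: "nat set \<Rightarrow> nat set set set" where
  "NC_irr_on S = {\<pi> \<in> NC_on S. \<exists>V\<in>\<pi>. Min S \<in> V \<and> Max S \<in> V}"

text \<open>One weight covers all cumulant formulas: \<open>u = (\<lambda>_. 1)\<close> gives the free and c-free ones,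
  \<open>u = (\<lambda>k. s / k)\<close> gives \<open>s ^ |\<pi>| / t(\<pi>)!\<close> for the monotone and c-monotone ones.\<close>

definition weight ::
    "(nat \<Rightarrow> complex) \<Rightarrow> (nat set \<Rightarrow> complex) \<Rightarrow> (nat set \<Rightarrow> complex) \<Rightarrow> nat set set \<Rightarrow> complex" where
  "weight u f g \<pi> =
     (\<Prod>V\<in>\<pi>. u (hook \<pi> V)) * (\<Prod>V\<in>outer_blocks \<pi>. f V) * (\<Prod>V\<in>inner_blocks \<pi>. g V)"

definition NC_sum ::
    "(nat \<Rightarrow> complex) \<Rightarrow> (nat set \<Rightarrow> complex) \<Rightarrow> (nat set \<Rightarrow> complex) \<Rightarrow> nat set \<Rightarrow> complex" where
  "NC_sum u f g S = (\<Sum>\<pi>\<in>NC_on S. weight u f g \<pi>)"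

definition irr_sum ::
    "(nat \<Rightarrow> complex) \<Rightarrow> (nat set \<Rightarrow> complex) \<Rightarrow> (nat set \<Rightarrow> complex) \<Rightarrow> nat set \<Rightarrow> complex" where
  "irr_sum u f g S = (\<Sum>\<pi>\<in>NC_irr_on S. weight u f g \<pi>)"

lemma prod_outer_inner:
  fixes g :: "nat set \<Rightarrow> complex"
  assumes "finite \<pi>"
  shows "(\<Prod>V\<in>outer_blocks \<pi>. g V) * (\<Prod>V\<in>inner_blocks \<pi>. g V) = (\<Prod>V\<in>\<pi>. g V)"
  unfolding inner_blocks_def
  using prod.subset_diff[OF outer_blocks_subset assms, of g] by (simp add: mult.commute)

lemma weight_same:
  assumes "finite \<pi>"
  shows "weight u g g \<pi> = (\<Prod>V\<in>\<pi>. u (hook \<pi> V) * g V)"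
  using prod_outer_inner[OF assms, of g] by (simp add: weight_def prod.distrib mult.assoc)

lemma weight_empty [simp]: "weight u f g {} = 1"
  by (simp add: weight_def outer_blocks_def inner_blocks_def)

lemma NC_sum_empty [simp]: "NC_sum u f g {} = 1"
  by (simp add: NC_sum_def NC_on_empty)

lemma block_of_eq:
  assumes "\<pi> \<in> NC_on S" "V \<in> \<pi>" "i \<in> V"
  shows "block_of \<pi> i = V"
  unfolding block_of_def using NC_on_disjoint[OF assms(1)] assms by (intro the_equality) auto

lemma block_of_in:
  assumes "\<pi> \<in> NC_on S" "i \<in> S"
  shows "block_of \<pi> i \<in> \<pi>" "i \<in> block_of \<pi> i"
proof -
  obtain V where "V \<in> \<pi>" "i \<in> V"
    using assms(2) partition_onD1[OF NC_onD(1)[OF assms(1)]] by blast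
  then show "block_of \<pi> i \<in> \<pi>" "i \<in> block_of \<pi> i"
    using block_of_eq[OF assms(1)] by auto
qed

lemma NC_on_subset:
  assumes "\<pi> \<in> NC_on S" "\<rho> \<subseteq> \<pi>" "\<Union>\<rho> = T"
  shows "\<rho> \<in> NC_on T"
proof -
  have "partition_on T \<rho>"
    using NC_onD(1)[OF assms(1)] assms(2,3) unfolding partition_on_def disjoint_def by auto
  moreover have "noncrossing \<rho>"
    using NC_onD(2)[OF assms(1)] assms(2) unfolding noncrossing_def
    by (meson subsetD)
  ultimately show ?thesis by (simp add: NC_on_def)
qed

lemma NC_on_Union: "\<pi> \<in> NC_on S \<Longrightarrow> \<Union>\<pi> = S"
  using partition_onD1[OF NC_onD(1)] by blast

lemma NC_on_union:
  assumes "\<forall>x\<in>S. \<forall>y\<in>T. x < y" "\<pi> \<in> NC_on S" "\<rho> \<in> NC_on T"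
  shows "\<pi> \<union> \<rho> \<in> NC_on (S \<union> T)"
proof -
  have disj: "S \<inter> T = {}" using assms(1) by fastforce
  have "partition_on (S \<union> T) (\<pi> \<union> \<rho>)"
  proof (rule partition_onI)
    fix V W assume VW: "V \<in> \<pi> \<union> \<rho>" "W \<in> \<pi> \<union> \<rho>" "V \<noteq> W"
    have "V = W" if "x \<in> V" "x \<in> W" for x
    proof -
      have "V \<in> \<pi> \<and> W \<in> \<pi> \<or> V \<in> \<rho> \<and> W \<in> \<rho>"
      proof -
        have "\<not> (x \<in> S \<and> x \<in> T)" using disj by auto
        moreover have "x \<in> S" if "U \<in> \<pi>" "x \<in> U" for U
          using NC_on_block(1)[OF assms(2) that(1)] that(2) by auto
        moreover have "x \<in> T" if "U \<in> \<rho>" "x \<in> U" for U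
          using NC_on_block(1)[OF assms(3) that(1)] that(2) by auto
        ultimately show ?thesis using VW(1,2) \<open>x \<in> V\<close> \<open>x \<in> W\<close> by blast
      qed
      then show ?thesis
        using NC_on_disjoint[OF assms(2) _ _ that] NC_on_disjoint[OF assms(3) _ _ that] by auto
    qed
    then show "disjnt V W" using VW(3) by (auto simp: disjnt_def)
  qed (use NC_on_Union[OF assms(2)] NC_on_Union[OF assms(3)]
       NC_on_block(2)[OF assms(2)] NC_on_block(2)[OF assms(3)] in auto)
  moreover have "noncrossing (\<pi> \<union> \<rho>)"
    unfolding noncrossing_def
  proof (intro ballI impI notI, elim exE conjE)
    fix V W a b c d
    assume VW: "V \<in> \<pi> \<union> \<rho>" "W \<in> \<pi> \<union> \<rho>" "V \<noteq> W"
      and o: "a < b" "b < c" "c < (d::nat)" "a \<in> V" "c \<in> V" "b \<in> W" "d \<in> W"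
    have "V \<subseteq> S \<and> W \<subseteq> T \<longrightarrow> b > c" "V \<subseteq> T \<and> W \<subseteq> S \<longrightarrow> d < a"
      using assms(1) o by blast+
    then consider "V \<in> \<pi>" "W \<in> \<pi>" | "V \<in> \<rho>" "W \<in> \<rho>"
      using VW o NC_on_block(1)[OF assms(2)] NC_on_block(1)[OF assms(3)]
      by (metis UnE order.strict_trans not_less_iff_gr_or_eq)
    then show False
      using NC_on_noncross[OF assms(2) _ _ VW(3) o] NC_on_noncross[OF assms(3) _ _ VW(3) o]
      by cases auto
  qed
  ultimately show ?thesis by (simp add: NC_on_def)
qed

lemma NC_on_part:
  assumes "S \<inter> T = {}" "\<sigma> \<in> NC_on (S \<union> T)" "\<forall>W\<in>\<sigma>. W \<subseteq> S \<or> W \<subseteq> T"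
  shows "{W \<in> \<sigma>. W \<subseteq> S} \<in> NC_on S"
proof (rule NC_on_subset[OF assms(2)])
  show "\<Union>{W \<in> \<sigma>. W \<subseteq> S} = S"
  proof
    show "S \<subseteq> \<Union>{W \<in> \<sigma>. W \<subseteq> S}"
    proof
      fix x assume x: "x \<in> S"
      then obtain W where "W \<in> \<sigma>" "x \<in> W" using NC_on_Union[OF assms(2)] by auto
      moreover from this have "W \<subseteq> S" using assms(1,3) x by auto
      ultimately show "x \<in> \<Union>{W \<in> \<sigma>. W \<subseteq> S}" by auto
    qed
  qed auto
qed auto

lemma NC_on_parts:
  assumes "S \<inter> T = {}" "\<sigma> \<in> NC_on (S \<union> T)" "\<forall>W\<in>\<sigma>. W \<subseteq> S \<or> W \<subseteq> T"
  shows "{W \<in> \<sigma>. W \<subseteq> S} \<in> NC_on S" "{W \<in> \<sigma>. W \<subseteq> T} \<in> NC_on T"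
    "{W \<in> \<sigma>. W \<subseteq> S} \<union> {W \<in> \<sigma>. W \<subseteq> T} = \<sigma>"
proof -
  show "{W \<in> \<sigma>. W \<subseteq> T} \<in> NC_on T"
    by (rule NC_on_part[of T S]) (use assms in \<open>auto simp: Un_commute Int_commute\<close>)
qed (use NC_on_part[OF assms] assms(3) in auto)

lemma parts_union:
  assumes "S \<inter> T = {}" "\<pi> \<in> NC_on S" "\<rho> \<in> NC_on T"
  shows "{W \<in> \<pi> \<union> \<rho>. W \<subseteq> S} = \<pi>" "{W \<in> \<pi> \<union> \<rho>. W \<subseteq> T} = \<rho>"
proof -
  have "W \<subseteq> S" "\<not> W \<subseteq> T" if "W \<in> \<pi>" for W
    using NC_on_block[OF assms(2) that] assms(1) by auto
  moreover have "W \<subseteq> T" "\<not> W \<subseteq> S" if "W \<in> \<rho>" for W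
    using NC_on_block[OF assms(3) that] assms(1) by auto
  ultimately show "{W \<in> \<pi> \<union> \<rho>. W \<subseteq> S} = \<pi>" "{W \<in> \<pi> \<union> \<rho>. W \<subseteq> T} = \<rho>"
    unfolding set_eq_iff mem_Collect_eq Un_iff by metis+
qed

text \<open>Blocks of \<open>S\<close> and of \<open>T\<close> are never nested in each other, so hooks and outer blocks of the union
  are those of the two parts.\<close>

lemma weight_union:
  assumes "\<forall>x\<in>S. \<forall>y\<in>T. x < y" "\<pi> \<in> NC_on S" "\<rho> \<in> NC_on T" "finite S" "finite T"
  shows "weight u f g (\<pi> \<union> \<rho>) = weight u f g \<pi> * weight u f g \<rho>"
proof -
  have fin: "finite \<pi>" "finite \<rho>" using assms NC_on_finite by auto
  have disj: "\<pi> \<inter> \<rho> = {}"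
    using NC_on_block[OF assms(2)] NC_on_block[OF assms(3)] assms(1) by fastforce
  have no: "\<not> nests V W" "\<not> nests W V" if VW: "V \<in> \<pi>" "W \<in> \<rho>" for V W
  proof -
    obtain v w where "v \<in> V" "w \<in> W"
      using NC_on_block(2)[OF assms(2) VW(1)] NC_on_block(2)[OF assms(3) VW(2)] by blast
    moreover have "V \<subseteq> S" "W \<subseteq> T"
      using NC_on_block(1)[OF assms(2) VW(1)] NC_on_block(1)[OF assms(3) VW(2)] by auto
    ultimately show "\<not> nests V W" "\<not> nests W V"
      using assms(1) unfolding nests_def by (meson less_asym subsetD)+
  qed
  have hook: "hook (\<pi> \<union> \<rho>) V = hook \<pi> V" if "V \<in> \<pi>" for V
    using no that disj unfolding hook_def below_def by (intro arg_cong[where f = card]) auto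
  have hook': "hook (\<pi> \<union> \<rho>) V = hook \<rho> V" if "V \<in> \<rho>" for V
    using no that disj unfolding hook_def below_def by (intro arg_cong[where f = card]) auto
  have outer: "outer_blocks (\<pi> \<union> \<rho>) = outer_blocks \<pi> \<union> outer_blocks \<rho>"
    using no unfolding outer_blocks_def by blast
  have inner: "inner_blocks (\<pi> \<union> \<rho>) = inner_blocks \<pi> \<union> inner_blocks \<rho>"
    unfolding inner_blocks_def outer using disj outer_blocks_subset[of \<pi>] outer_blocks_subset[of \<rho>]
    by blast
  have d: "outer_blocks \<pi> \<inter> outer_blocks \<rho> = {}" "inner_blocks \<pi> \<inter> inner_blocks \<rho> = {}"
    using disj unfolding inner_blocks_def outer_blocks_def by blast+
  have f: "finite (outer_blocks \<pi>)" "finite (outer_blocks \<rho>)"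
     "finite (inner_blocks \<pi>)" "finite (inner_blocks \<rho>)"
    using fin unfolding inner_blocks_def outer_blocks_def by auto
  show ?thesis
    unfolding weight_def outer inner
    by (simp add: prod.union_disjoint fin f disj d hook hook' mult_ac)
qed

section \<open>Filling gaps and removing outer blocks\<close>

text \<open>A block that does not straddle \<open>b\<close> lies on one side of \<open>b\<close>, and blocks before \<open>b\<close> are not
  constrained by the other elements of \<open>V\<close>.\<close>

lemma bij_betw_NC_gaps_split_first:
  assumes "finite V" "V \<subseteq> S" "b \<in> V" "\<forall>v\<in>V. b \<le> v"
  shows "bij_betw (\<lambda>(\<pi>, \<rho>). \<pi> \<union> \<rho>)
    (NC_on (S \<inter> {..<b}) \<times> NC_gaps (S \<inter> {b<..}) (V \<inter> {b<..})) (NC_gaps S V)"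
proof -
  let ?L = "S \<inter> {..<b}" and ?R = "S \<inter> {b<..} - V \<inter> {b<..}"
  have SV: "S - V = ?L \<union> ?R" using assms by (auto simp: not_less order.strict_iff_order)
  have disj: "?L \<inter> ?R = {}" by auto
  have less: "\<forall>x\<in>?L. \<forall>y\<in>?R. x < y" by auto
  show ?thesis
  proof (rule bij_betw_byWitness[where f' = "\<lambda>\<sigma>. ({W \<in> \<sigma>. W \<subseteq> ?L}, {W \<in> \<sigma>. W \<subseteq> ?R})"])
    show "\<forall>p\<in>NC_on ?L \<times> NC_gaps (S \<inter> {b<..}) (V \<inter> {b<..}).
        (\<lambda>\<sigma>. ({W \<in> \<sigma>. W \<subseteq> ?L}, {W \<in> \<sigma>. W \<subseteq> ?R})) (case p of (\<pi>, \<rho>) \<Rightarrow> \<pi> \<union> \<rho>) = p"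
      using parts_union[OF disj] by (auto simp: NC_gaps_def)
    have sub: "\<forall>W\<in>\<sigma>. W \<subseteq> ?L \<or> W \<subseteq> ?R" if \<sigma>: "\<sigma> \<in> NC_gaps S V" for \<sigma>
    proof
      fix W assume W: "W \<in> \<sigma>"
      then have "W \<subseteq> ?L \<union> ?R" "\<not> straddles W b"
        using \<sigma> assms(3) NC_on_block(1)[of \<sigma> "S - V" W] SV by (auto simp: NC_gaps_def)
      then show "W \<subseteq> ?L \<or> W \<subseteq> ?R" unfolding straddles_def by blast
    qed
    show "\<forall>\<sigma>\<in>NC_gaps S V. (case ({W \<in> \<sigma>. W \<subseteq> ?L}, {W \<in> \<sigma>. W \<subseteq> ?R}) of (\<pi>, \<rho>) \<Rightarrow> \<pi> \<union> \<rho>) = \<sigma>"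
      using sub by auto
    show "(\<lambda>(\<pi>, \<rho>). \<pi> \<union> \<rho>) ` (NC_on ?L \<times> NC_gaps (S \<inter> {b<..}) (V \<inter> {b<..})) \<subseteq> NC_gaps S V"
    proof (clarsimp)
      fix \<pi> \<rho> assume *: "\<pi> \<in> NC_on ?L" "\<rho> \<in> NC_gaps (S \<inter> {b<..}) (V \<inter> {b<..})"
      then have \<rho>: "\<rho> \<in> NC_on ?R" "\<forall>W\<in>\<rho>. \<forall>v\<in>V \<inter> {b<..}. \<not> straddles W v"
        by (auto simp: NC_gaps_def)
      have "\<not> straddles W v" if "W \<in> \<pi>" "v \<in> V" for W v
        using NC_on_block(1)[OF *(1) that(1)] assms(4) that(2) unfolding straddles_def by fastforce
      moreover have "\<not> straddles W v" if "W \<in> \<rho>" "v \<in> V" for W v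
      proof (cases "v = b")
        case True
        then show ?thesis
          using NC_on_block(1)[OF \<rho>(1) that(1)] unfolding straddles_def by fastforce
      qed (use that \<rho>(2) assms(4) in force)
      ultimately show "\<pi> \<union> \<rho> \<in> NC_gaps S V"
        using NC_on_union[OF less *(1) \<rho>(1)] SV by (auto simp: NC_gaps_def)
    qed
    show "(\<lambda>\<sigma>. ({W \<in> \<sigma>. W \<subseteq> ?L}, {W \<in> \<sigma>. W \<subseteq> ?R})) ` NC_gaps S V
        \<subseteq> NC_on ?L \<times> NC_gaps (S \<inter> {b<..}) (V \<inter> {b<..})"
    proof (rule image_subsetI)
      fix \<sigma> assume \<sigma>: "\<sigma> \<in> NC_gaps S V"
      then have "\<sigma> \<in> NC_on (?L \<union> ?R)" using SV by (simp add: NC_gaps_def)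
      from NC_on_parts(1,2)[OF disj this sub[OF \<sigma>]] \<sigma>
      show "({W \<in> \<sigma>. W \<subseteq> ?L}, {W \<in> \<sigma>. W \<subseteq> ?R})
          \<in> NC_on ?L \<times> NC_gaps (S \<inter> {b<..}) (V \<inter> {b<..})"
        by (auto simp: NC_gaps_def)
    qed
  qed
qed

text \<open>The partitions of the different gaps are chosen independently and the weight is multiplicative.
  The induction splits off the first gap.\<close>

lemma sum_NC_gaps_weight:
  assumes "finite S" "V \<subseteq> S"
  shows "(\<Sum>\<rho>\<in>NC_gaps S V. weight u f g \<rho>) = gap_product (NC_sum u f g) S V"
  using assms
proof (induction "card V" arbitrary: S V rule: less_induct)
  case less
  have fin: "finite V" using less.prems finite_subset by blast
  show ?case
  proof (cases "V = {}")
    case True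
    then show ?thesis by (simp add: NC_gaps_def NC_sum_def)
  next
    case False
    define b where "b = Min V"
    have b: "b \<in> V" "\<forall>v\<in>V. b \<le> v" using fin False by (auto simp: b_def)
    have "V \<inter> {..<b} = {}" using b(2) by (auto simp: not_le[symmetric])
    have less': "card (V \<inter> {b<..}) < card V"
      using b(1) by (intro psubset_card_mono fin) auto
    have IH: "(\<Sum>\<rho>\<in>NC_gaps (S \<inter> {b<..}) (V \<inter> {b<..}). weight u f g \<rho>) =
        gap_product (NC_sum u f g) (S \<inter> {b<..}) (V \<inter> {b<..})"
      using less.prems by (intro less.hyps[OF less']) auto
    have "(\<Sum>\<sigma>\<in>NC_gaps S V. weight u f g \<sigma>) =
        (\<Sum>(\<pi>, \<rho>)\<in>NC_on (S \<inter> {..<b}) \<times> NC_gaps (S \<inter> {b<..}) (V \<inter> {b<..}). weight u f g (\<pi> \<union> \<rho>))"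
      by (subst sum.reindex_bij_betw[OF bij_betw_NC_gaps_split_first[OF fin less.prems(2) b], symmetric])
        (simp add: case_prod_unfold)
    also have "\<dots> = (\<Sum>(\<pi>, \<rho>)\<in>NC_on (S \<inter> {..<b}) \<times> NC_gaps (S \<inter> {b<..}) (V \<inter> {b<..}).
        weight u f g \<pi> * weight u f g \<rho>)"
      using less.prems(1)
      by (intro sum.cong refl)
        (auto simp: NC_gaps_def intro!: weight_union[where S = "S \<inter> {..<b}"
            and T = "S \<inter> {b<..} - V \<inter> {b<..}"])
    also have "\<dots> = NC_sum u f g (S \<inter> {..<b}) *
        gap_product (NC_sum u f g) (S \<inter> {b<..}) (V \<inter> {b<..})"
      by (simp add: NC_sum_def IH[symmetric] sum_product sum.cartesian_product)
    also have "\<dots> = gap_product (NC_sum u f g) S V"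
      using gap_product_split[OF fin b(1)] \<open>V \<inter> {..<b} = {}\<close> by simp
    finally show ?thesis .
  qed
qed

text \<open>If \<open>V\<close> crossed a block of \<open>\<rho>\<close> or were nested in it, that block would straddle an element of \<open>V\<close>.\<close>

lemma NC_gaps_insert:
  assumes "V \<subseteq> S" "V \<noteq> {}" "\<rho> \<in> NC_gaps S V"
  shows "insert V \<rho> \<in> NC_on S" "V \<in> outer_blocks (insert V \<rho>)" "V \<notin> \<rho>"
    "\<And>W. W \<in> \<rho> \<Longrightarrow> \<not> nests W V"
proof -
  have \<rho>: "\<rho> \<in> NC_on (S - V)" "\<And>W v. W \<in> \<rho> \<Longrightarrow> v \<in> V \<Longrightarrow> \<not> straddles W v"
    using assms(3) by (auto simp: NC_gaps_def)
  show notin: "V \<notin> \<rho>" using NC_on_block(1)[OF \<rho>(1), of V] assms(2) by auto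
  have "partition_on S (insert V \<rho>)"
    using assms NC_onD(1)[OF \<rho>(1)] NC_on_block(1)[OF \<rho>(1)] NC_on_Union[OF \<rho>(1)]
    unfolding partition_on_def disjoint_def by auto
  moreover have "noncrossing (insert V \<rho>)"
    unfolding noncrossing_def
  proof (intro ballI impI notI, elim exE conjE)
    fix U W a b c d
    assume VW: "U \<in> insert V \<rho>" "W \<in> insert V \<rho>" "U \<noteq> W"
      and o: "a < b" "b < c" "c < (d::nat)" "a \<in> U" "c \<in> U" "b \<in> W" "d \<in> W"
    consider "U = V" "W \<in> \<rho>" | "W = V" "U \<in> \<rho>" | "U \<in> \<rho>" "W \<in> \<rho>" using VW by blast
    then show False
    proof cases
      case 1 then show False using \<rho>(2)[of W c] o by (auto simp: straddles_def)
    next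
      case 2 then show False using \<rho>(2)[of U b] o by (auto simp: straddles_def)
    next
      case 3 then show False using NC_on_noncross[OF \<rho>(1) _ _ VW(3) o] by blast
    qed
  qed
  ultimately show "insert V \<rho> \<in> NC_on S" by (simp add: NC_on_def)
  show no: "\<not> nests W V" if "W \<in> \<rho>" for W
    using \<rho>(2)[OF that] nests_straddles assms(2) by blast
  then show "V \<in> outer_blocks (insert V \<rho>)"
    using nests_irrefl by (auto simp: outer_blocks_def)
qed

lemma NC_gaps_remove:
  assumes "\<pi> \<in> NC_on S" "V \<in> outer_blocks \<pi>"
  shows "\<pi> - {V} \<in> NC_gaps S V"
proof -
  have V: "V \<in> \<pi>" using assms(2) outer_blocks_subset by blast
  have "\<Union>(\<pi> - {V}) = S - V"
    using NC_on_Union[OF assms(1)] NC_on_disjoint[OF assms(1) V] by blast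
  then have "\<pi> - {V} \<in> NC_on (S - V)" by (intro NC_on_subset[OF assms(1)]) auto
  moreover have "\<not> straddles W v" if "W \<in> \<pi> - {V}" "v \<in> V" for W v
    using straddles_imp_nests[OF assms(1) _ V _ that(2)] that(1) assms(2)
    by (auto simp: outer_blocks_def)
  ultimately show ?thesis by (simp add: NC_gaps_def)
qed

text \<open>Pairs of a partition and one of its outer blocks correspond to a nonempty \<open>V\<close> with a configuration in
  its gaps, by removing and inserting \<open>V\<close>.\<close>

lemma sum_outer_blocks:
  assumes "finite S"
  shows "(\<Sum>\<pi>\<in>NC_on S. \<Sum>V\<in>outer_blocks \<pi>. F V (\<pi> - {V})) =
    (\<Sum>V\<in>Pow S - {{}}. \<Sum>\<rho>\<in>NC_gaps S V. F V \<rho>)"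
proof -
  have fin: "finite (outer_blocks \<pi>)" if "\<pi> \<in> NC_on S" for \<pi>
    using NC_on_finite[OF assms that] outer_blocks_subset finite_subset by blast
  have fin': "finite (NC_gaps S V)" for V
    using finite_NC_on[of "S - V"] assms by (simp add: NC_gaps_def)
  have "(\<Sum>\<pi>\<in>NC_on S. \<Sum>V\<in>outer_blocks \<pi>. F V (\<pi> - {V})) =
      (\<Sum>(\<pi>, V)\<in>Sigma (NC_on S) outer_blocks. F V (\<pi> - {V}))"
    using finite_NC_on[OF assms] fin by (subst sum.Sigma) auto
  also have "\<dots> = (\<Sum>(V, \<rho>)\<in>Sigma (Pow S - {{}}) (NC_gaps S). F V \<rho>)"
  proof (rule sum.reindex_bij_witness[where i = "\<lambda>(V, \<rho>). (insert V \<rho>, V)"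
        and j = "\<lambda>(\<pi>, V). (V, \<pi> - {V})"], goal_cases)
    case (1 p)
    then show ?case using outer_blocks_subset by auto
  next
    case (2 p)
    then obtain \<pi> V where p: "p = (\<pi>, V)" "\<pi> \<in> NC_on S" "V \<in> outer_blocks \<pi>" by auto
    then have "V \<in> \<pi>" using outer_blocks_subset by blast
    then show ?case using p NC_gaps_remove[OF p(2,3)] NC_on_block[OF p(2)] by simp
  next
    case (3 q)
    then show ?case using NC_gaps_insert(3) by (auto simp: insert_Diff_if)
  next
    case (4 q)
    then obtain V \<rho> where q: "q = (V, \<rho>)" "V \<subseteq> S" "V \<noteq> {}" "\<rho> \<in> NC_gaps S V" by auto
    then show ?case using NC_gaps_insert(1,2)[OF q(2-)] by simp
  qed auto
  also have "\<dots> = (\<Sum>V\<in>Pow S - {{}}. \<Sum>\<rho>\<in>NC_gaps S V. F V \<rho>)"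
    using assms fin' by (subst sum.Sigma) auto
  finally show ?thesis .
qed

lemma irr_block_outer:
  assumes "\<pi> \<in> NC_on S" "finite S" "V \<in> \<pi>" "Min S \<in> V" "Max S \<in> V"
  shows "outer_blocks \<pi> = {V}" "W \<in> \<pi> \<Longrightarrow> W \<noteq> V \<Longrightarrow> nests V W"
proof -
  have *: "nests V W" if "W \<in> \<pi>" "W \<noteq> V" for W
  proof -
    have "Min S < w \<and> w < Max S" if "w \<in> W" for w
    proof -
      have "w \<in> S" "w \<notin> V"
        using \<open>W \<in> \<pi>\<close> that \<open>W \<noteq> V\<close> NC_on_disjoint[OF assms(1,3), of W w] NC_on_block(1)[OF assms(1)]
        by auto
      then show ?thesis
        using assms(2,4,5) by (metis Max_ge Min_le order.not_eq_order_implies_strict)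
    qed
    then show ?thesis using assms(4,5) unfolding nests_def by blast
  qed
  then show "W \<in> \<pi> \<Longrightarrow> W \<noteq> V \<Longrightarrow> nests V W" .
  have "\<not> nests W V" if "W \<in> \<pi>" for W
    using *[OF that] nests_irrefl nests_trans by metis
  then show "outer_blocks \<pi> = {V}" using * assms(3) unfolding outer_blocks_def by blast
qed

lemma sum_NC_irr_on:
  assumes "finite S" "S \<noteq> {}"
  shows "(\<Sum>\<pi>\<in>NC_irr_on S. F \<pi>) =
    (\<Sum>V\<in>{V\<in>Pow S. Min S \<in> V \<and> Max S \<in> V}. \<Sum>\<rho>\<in>NC_gaps S V. F (insert V \<rho>))"
proof -
  have fin': "finite (NC_gaps S V)" for V
    using finite_NC_on[of "S - V"] assms by (simp add: NC_gaps_def)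
  have "(\<Sum>\<pi>\<in>NC_irr_on S. F \<pi>) =
      (\<Sum>(V, \<rho>)\<in>Sigma {V\<in>Pow S. Min S \<in> V \<and> Max S \<in> V} (NC_gaps S). F (insert V \<rho>))"
  proof (rule sum.reindex_bij_witness[where i = "\<lambda>(V, \<rho>). insert V \<rho>"
        and j = "\<lambda>\<pi>. (block_of \<pi> (Min S), \<pi> - {block_of \<pi> (Min S)})"])
    fix \<pi> assume "\<pi> \<in> NC_irr_on S"
    then obtain V where V: "\<pi> \<in> NC_on S" "V \<in> \<pi>" "Min S \<in> V" "Max S \<in> V"
      by (auto simp: NC_irr_on_def)
    have eq: "block_of \<pi> (Min S) = V" using block_of_eq V by blast
    have "\<pi> - {V} \<in> NC_gaps S V"
      using irr_block_outer(1)[OF V(1) assms(1) V(2-)] NC_gaps_remove[OF V(1)] by blast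
    then show "(block_of \<pi> (Min S), \<pi> - {block_of \<pi> (Min S)})
        \<in> Sigma {V\<in>Pow S. Min S \<in> V \<and> Max S \<in> V} (NC_gaps S)"
      using eq V NC_on_block(1)[OF V(1,2)] by simp
    show "(case (block_of \<pi> (Min S), \<pi> - {block_of \<pi> (Min S)}) of (V, \<rho>) \<Rightarrow> insert V \<rho>) = \<pi>"
      "(case (block_of \<pi> (Min S), \<pi> - {block_of \<pi> (Min S)}) of (V, \<rho>) \<Rightarrow> F (insert V \<rho>)) = F \<pi>"
      using eq V(2) by (simp_all add: insert_absorb)
  next
    fix q assume "q \<in> Sigma {V\<in>Pow S. Min S \<in> V \<and> Max S \<in> V} (NC_gaps S)"
    then obtain V \<rho> where q: "q = (V, \<rho>)" "V \<subseteq> S" "Min S \<in> V" "Max S \<in> V" "\<rho> \<in> NC_gaps S V"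
      by auto
    have ins: "insert V \<rho> \<in> NC_on S" "V \<notin> \<rho>" using q NC_gaps_insert[of V S \<rho>] by auto
    have "block_of (insert V \<rho>) (Min S) = V" using block_of_eq[OF ins(1)] q by blast
    then show "(block_of (case q of (V, \<rho>) \<Rightarrow> insert V \<rho>) (Min S), (case q of (V, \<rho>) \<Rightarrow> insert V \<rho>) -
        {block_of (case q of (V, \<rho>) \<Rightarrow> insert V \<rho>) (Min S)}) = q"
      using q ins by auto
    show "(case q of (V, \<rho>) \<Rightarrow> insert V \<rho>) \<in> NC_irr_on S"
      using q ins by (auto simp: NC_irr_on_def)
  qed
  also have "\<dots> = (\<Sum>V\<in>{V\<in>Pow S. Min S \<in> V \<and> Max S \<in> V}. \<Sum>\<rho>\<in>NC_gaps S V. F (insert V \<rho>))"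
    using assms fin' by (subst sum.Sigma) auto
  finally show ?thesis .
qed

text \<open>No block of \<open>\<rho>\<close> can have \<open>V\<close> below it.\<close>

lemma hook_insert_outer:
  assumes "V \<subseteq> S" "V \<noteq> {}" "\<rho> \<in> NC_gaps S V" "W \<in> \<rho>"
  shows "hook (insert V \<rho>) W = hook \<rho> W"
proof -
  have "below (insert V \<rho>) W = below \<rho> W"
    using NC_gaps_insert(3,4)[OF assms(1-3)] assms(4) unfolding below_def by blast
  then show ?thesis by (simp add: hook_def)
qed

text \<open>All blocks are nested in \<open>V\<close>, so its hook is the total number of blocks, and \<open>V\<close> is the only outer
  block.\<close>

lemma weight_insert_irr:
  assumes "finite S" "V \<subseteq> S" "Min S \<in> V" "Max S \<in> V" "\<rho> \<in> NC_gaps S V"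
  shows "weight u f g (insert V \<rho>) = u (Suc (card \<rho>)) * f V * weight u g g \<rho>"
proof -
  have ne: "V \<noteq> {}" using assms(3) by auto
  note ins = NC_gaps_insert[OF assms(2) ne assms(5)]
  have "finite (S - V)" using assms(1) by simp
  then have fin: "finite \<rho>" using assms(5) NC_on_finite[of "S - V"] by (auto simp: NC_gaps_def)
  have outer: "outer_blocks (insert V \<rho>) = {V}"
    using irr_block_outer(1)[OF ins(1) assms(1)] assms by blast
  have inner: "inner_blocks (insert V \<rho>) = \<rho>"
    using outer ins(3) by (auto simp: inner_blocks_def)
  have "below (insert V \<rho>) V = insert V \<rho>"
    using irr_block_outer(2)[OF ins(1) assms(1)] assms unfolding below_def by blast
  then have "hook (insert V \<rho>) V = Suc (card \<rho>)" using fin ins(3) by (simp add: hook_def)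
  moreover have "(\<Prod>W\<in>\<rho>. u (hook (insert V \<rho>) W)) = (\<Prod>W\<in>\<rho>. u (hook \<rho> W))"
    using hook_insert_outer[OF assms(2) ne assms(5)] by simp
  ultimately show ?thesis
    using fin ins(3) unfolding weight_same[OF fin] unfolding weight_def outer inner
    by (simp add: prod.distrib)
qed

section \<open>Decomposition into irreducible components\<close>

text \<open>Let \<open>m\<close> be the last element of the block of \<open>Min S\<close>. A block with elements on both sides of \<open>m\<close> would
  have that block nested inside it, which \<open>Min S\<close> forbids; hence the partition splits at \<open>m\<close> into an
  irreducible one and an arbitrary one.\<close>

lemma NC_sum_first_irr:
  assumes "finite S" "S \<noteq> {}"
  shows "NC_sum u f g S = (\<Sum>m\<in>S. irr_sum u f g (S \<inter> {..m}) * NC_sum u f g (S \<inter> {m<..}))"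
proof -
  let ?m = "\<lambda>\<sigma>. Max (block_of \<sigma> (Min S))"
  let ?L = "\<lambda>m. S \<inter> {..m}" and ?R = "\<lambda>m. S \<inter> {m<..}"
  have LR: "?L m \<union> ?R m = S" "?L m \<inter> ?R m = {}" "\<forall>x\<in>?L m. \<forall>y\<in>?R m. x < y" for m
    by auto
  have MinL: "Min (?L m) = Min S" and MaxL: "Max (?L m) = m" if "m \<in> S" for m
    using that assms Min_le[OF assms(1) that] by (auto intro!: Min_eqI Max_eqI Min_in)
  have "NC_sum u f g S =
      (\<Sum>(m, \<pi>, \<rho>)\<in>(SIGMA m:S. NC_irr_on (?L m) \<times> NC_on (?R m)). weight u f g \<pi> * weight u f g \<rho>)"
    unfolding NC_sum_def
  proof (rule sum.reindex_bij_witness[where i = "\<lambda>(m, \<pi>, \<rho>). \<pi> \<union> \<rho>"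
        and j = "\<lambda>\<sigma>. (?m \<sigma>, {W \<in> \<sigma>. W \<subseteq> ?L (?m \<sigma>)}, {W \<in> \<sigma>. W \<subseteq> ?R (?m \<sigma>)})"])
    fix \<sigma> assume \<sigma>: "\<sigma> \<in> NC_on S"
    define V where "V = block_of \<sigma> (Min S)"
    define m where "m = Max V"
    have MinS: "Min S \<in> S" using assms by simp
    have V: "V \<in> \<sigma>" "Min S \<in> V" using block_of_in[OF \<sigma> MinS] by (auto simp: V_def)
    have VS: "V \<subseteq> S" "finite V" using NC_on_block(1)[OF \<sigma> V(1)] assms finite_subset by auto
    have mV: "m \<in> V" "\<forall>v\<in>V. v \<le> m" using V VS by (auto simp: m_def intro: Max_in)
    have sub: "\<forall>W\<in>\<sigma>. W \<subseteq> ?L m \<or> W \<subseteq> ?R m"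
    proof (intro ballI, rule ccontr)
      fix W assume W: "W \<in> \<sigma>" "\<not> (W \<subseteq> ?L m \<or> W \<subseteq> ?R m)"
      then obtain x z where xz: "x \<in> W" "z \<in> W" "x \<le> m" "m < z"
        using NC_on_block(1)[OF \<sigma> W(1)] by (auto simp: not_less not_le subset_iff)
      have "W \<noteq> V" using xz mV by auto
      then have "x \<noteq> m" using NC_on_disjoint[OF \<sigma> W(1) V(1)] xz mV by auto
      then have "straddles W m" using xz unfolding straddles_def by (meson order.not_eq_order_implies_strict)
      then have "nests W V" using straddles_imp_nests[OF \<sigma> W(1) V(1)] \<open>W \<noteq> V\<close> mV by blast
      then obtain y where "y \<in> W" "y < Min S" using V(2) unfolding nests_def by blast
      then show False
        using NC_on_block(1)[OF \<sigma> W(1)] Min_le[OF assms(1), of y] by auto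
    qed
    have \<sigma>': "\<sigma> \<in> NC_on (?L m \<union> ?R m)" using \<sigma> LR by simp
    note parts = NC_on_parts[OF LR(2) \<sigma>' sub]
    have mS: "m \<in> S" using mV VS by auto
    have "V \<in> {W \<in> \<sigma>. W \<subseteq> ?L m}" using V VS mV by auto
    then have irr: "{W \<in> \<sigma>. W \<subseteq> ?L m} \<in> NC_irr_on (?L m)"
      using parts(1) V(2) mV(1) unfolding NC_irr_on_def MinL[OF mS] MaxL[OF mS] by blast
    show "(case (?m \<sigma>, {W \<in> \<sigma>. W \<subseteq> ?L (?m \<sigma>)}, {W \<in> \<sigma>. W \<subseteq> ?R (?m \<sigma>)}) of
        (m, \<pi>, \<rho>) \<Rightarrow> \<pi> \<union> \<rho>) = \<sigma>"
      using parts(3) by (simp add: m_def V_def)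
    show "(?m \<sigma>, {W \<in> \<sigma>. W \<subseteq> ?L (?m \<sigma>)}, {W \<in> \<sigma>. W \<subseteq> ?R (?m \<sigma>)})
        \<in> (SIGMA m:S. NC_irr_on (?L m) \<times> NC_on (?R m))"
      using irr parts(2) mS by (simp add: m_def V_def)
    show "(case (?m \<sigma>, {W \<in> \<sigma>. W \<subseteq> ?L (?m \<sigma>)}, {W \<in> \<sigma>. W \<subseteq> ?R (?m \<sigma>)}) of
        (m, \<pi>, \<rho>) \<Rightarrow> weight u f g \<pi> * weight u f g \<rho>) = weight u f g \<sigma>"
      using weight_union[OF LR(3) parts(1,2), of u f g] parts(3) assms(1) by (simp add: m_def V_def)
  next
    fix q assume "q \<in> (SIGMA m:S. NC_irr_on (?L m) \<times> NC_on (?R m))"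
    then obtain m \<pi> \<rho> where q: "q = (m, \<pi>, \<rho>)" "m \<in> S" "\<pi> \<in> NC_irr_on (?L m)" "\<rho> \<in> NC_on (?R m)"
      by auto
    then obtain V where V: "\<pi> \<in> NC_on (?L m)" "V \<in> \<pi>" "Min S \<in> V" "m \<in> V"
      using MinL MaxL by (auto simp: NC_irr_on_def)
    have un: "\<pi> \<union> \<rho> \<in> NC_on S" using NC_on_union[OF LR(3) V(1) q(4)] LR(1) by simp
    have "block_of (\<pi> \<union> \<rho>) (Min S) = V" using block_of_eq[OF un] V by blast
    moreover have "Max V = m"
      using NC_on_block(1)[OF V(1,2)] V(4) assms(1)
      by (intro Max_eqI) (auto intro: finite_subset)
    ultimately have m: "?m (\<pi> \<union> \<rho>) = m" by simp
    show "(?m (case q of (m, \<pi>, \<rho>) \<Rightarrow> \<pi> \<union> \<rho>),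
        {W \<in> (case q of (m, \<pi>, \<rho>) \<Rightarrow> \<pi> \<union> \<rho>). W \<subseteq> ?L (?m (case q of (m, \<pi>, \<rho>) \<Rightarrow> \<pi> \<union> \<rho>))},
        {W \<in> (case q of (m, \<pi>, \<rho>) \<Rightarrow> \<pi> \<union> \<rho>). W \<subseteq> ?R (?m (case q of (m, \<pi>, \<rho>) \<Rightarrow> \<pi> \<union> \<rho>))}) = q"
      using parts_union[OF LR(2) V(1) q(4)] unfolding q(1) prod.case m by simp
    show "(case q of (m, \<pi>, \<rho>) \<Rightarrow> \<pi> \<union> \<rho>) \<in> NC_on S" using un q(1) by simp
  qed
  also have "\<dots> = (\<Sum>m\<in>S. \<Sum>(\<pi>, \<rho>)\<in>NC_irr_on (?L m) \<times> NC_on (?R m). weight u f g \<pi> * weight u f g \<rho>)"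
    using assms finite_NC_on by (subst sum.Sigma) (auto simp: NC_irr_on_def)
  also have "\<dots> = (\<Sum>m\<in>S. irr_sum u f g (?L m) * NC_sum u f g (?R m))"
    by (simp add: irr_sum_def NC_sum_def sum_product sum.cartesian_product)
  finally show ?thesis .
qed

text \<open>In \<open>NC_sum_first_irr\<close> the summand \<open>m = Max S\<close> is \<open>irr_sum u f g S\<close>, and the others involve irreducible
  sums of smaller sets only: these sums are the Boolean cumulants of the moments \<open>NC_sum u f g\<close>.\<close>

lemma irr_sum_unique:
  assumes "\<And>S. finite S \<Longrightarrow> S \<noteq> {} \<Longrightarrow> NC_sum u f g S = NC_sum u' f' g' S"
  shows "finite S \<Longrightarrow> S \<noteq> {} \<Longrightarrow> irr_sum u f g S = irr_sum u' f' g' S"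
proof (induction "card S" arbitrary: S rule: less_induct)
  case less
  have M: "Max S \<in> S" using less.prems by simp
  have L: "S \<inter> {..Max S} = S" and R: "S \<inter> {Max S<..} = {}"
    using Max_ge[OF less.prems(1)] by (auto simp: not_less[symmetric])
  have dec: "NC_sum u f g S = irr_sum u f g S +
      (\<Sum>m\<in>S - {Max S}. irr_sum u f g (S \<inter> {..m}) * NC_sum u f g (S \<inter> {m<..}))" for u f g
    unfolding NC_sum_first_irr[OF less.prems]
    by (subst sum.remove[OF less.prems(1) M]) (simp add: L R)
  have "(\<Sum>m\<in>S - {Max S}. irr_sum u f g (S \<inter> {..m}) * NC_sum u f g (S \<inter> {m<..})) =
      (\<Sum>m\<in>S - {Max S}. irr_sum u' f' g' (S \<inter> {..m}) * NC_sum u' f' g' (S \<inter> {m<..}))"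
  proof (rule sum.cong[OF refl])
    fix m assume m: "m \<in> S - {Max S}"
    have lt: "m < Max S" using m less.prems(1) by (simp add: order.not_eq_order_implies_strict)
    have "Max S \<notin> S \<inter> {..m}" using lt by simp
    then have "S \<inter> {..m} \<subset> S" using M by blast
    then have "card (S \<inter> {..m}) < card S" using less.prems(1) psubset_card_mono by blast
    then have "irr_sum u f g (S \<inter> {..m}) = irr_sum u' f' g' (S \<inter> {..m})"
      using m less.prems(1) by (intro less.hyps) auto
    moreover have "NC_sum u f g (S \<inter> {m<..}) = NC_sum u' f' g' (S \<inter> {m<..})"
      using lt M less.prems(1) by (intro assms) auto
    ultimately show "irr_sum u f g (S \<inter> {..m}) * NC_sum u f g (S \<inter> {m<..}) =
        irr_sum u' f' g' (S \<inter> {..m}) * NC_sum u' f' g' (S \<inter> {m<..})" by simp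
  qed
  then show ?case using dec[of u f g] dec[of u' f' g'] assms[OF less.prems] by simp
qed

section \<open>Monotone flows\<close>

lemma eq_of_same_derivative:
  fixes F G :: "complex \<Rightarrow> complex"
  assumes "\<And>s. (F has_field_derivative D s) (at s)" "\<And>s. (G has_field_derivative D s) (at s)"
    and "F 0 = G 0"
  shows "F s = G s"
proof -
  have "((\<lambda>s. F s - G s) has_field_derivative 0) (at s within UNIV)" for s
    using DERIV_diff[OF assms(1)[of s] assms(2)[of s]] by simp
  then obtain c where "\<And>s. F s - G s = c"
    using has_field_derivative_zero_constant[of UNIV "\<lambda>s. F s - G s"] by auto
  from this[of s] this[of 0] show ?thesis using assms(3) by simp
qed

lemma has_field_derivative_gap_comp_left:
  assumes "\<And>V. V \<subseteq> S \<Longrightarrow> ((\<lambda>s. F s V) has_field_derivative F' V) (at s)"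
  shows "((\<lambda>s. gap_comp (F s) g S) has_field_derivative gap_comp F' g S) (at s)"
  unfolding gap_comp_def using assms by (intro DERIV_sum DERIV_cmult_right) auto

lemma weight_scale:
  assumes "finite \<pi>"
  shows "weight (\<lambda>k. s / of_nat k) f g \<pi> = s ^ card \<pi> * weight (\<lambda>k. 1 / of_nat k) f g \<pi>"
proof -
  have "(\<Prod>V\<in>\<pi>. s / of_nat (hook \<pi> V)) = s ^ card \<pi> * (\<Prod>V\<in>\<pi>. 1 / of_nat (hook \<pi> V))"
    by (simp add: prod_dividef)
  then show ?thesis by (simp add: weight_def mult.assoc)
qed

lemma NC_sum_zero:
  assumes "finite S"
  shows "NC_sum (\<lambda>k. 0 / of_nat k) f g S = (if S = {} then 1 else 0)"
proof (cases "S = {}")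
  case False
  have "weight (\<lambda>k. 0 / of_nat k) f g \<pi> = 0" if "\<pi> \<in> NC_on S" for \<pi>
  proof -
    have "\<pi> \<noteq> {}" "finite \<pi>" using NC_on_Union[OF that] False NC_on_finite[OF assms that] by auto
    then show ?thesis by (auto simp: weight_def card_gt_0_iff)
  qed
  then show ?thesis using False by (simp add: NC_sum_def)
qed simp

text \<open>The hook of an outer block cancels its own factor in the weight, while the other hooks are
  unaffected by its removal.\<close>

lemma hook_weight_remove_outer:
  assumes "finite S" "\<pi> \<in> NC_on S" "V \<in> outer_blocks \<pi>"
  shows "of_nat (hook \<pi> V) * weight (\<lambda>k. 1 / of_nat k) h h \<pi> =
    h V * weight (\<lambda>k. 1 / of_nat k) h h (\<pi> - {V})"
proof -
  have V: "V \<in> \<pi>" using assms(3) outer_blocks_subset by blast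
  have fin: "finite \<pi>" "finite (\<pi> - {V})" using NC_on_finite[OF assms(1,2)] by auto
  have ins: "insert V (\<pi> - {V}) = \<pi>" using V by auto
  have hk: "hook \<pi> W = hook (\<pi> - {V}) W" if "W \<in> \<pi> - {V}" for W
    using hook_insert_outer[OF NC_on_block[OF assms(2) V] NC_gaps_remove[OF assms(2,3)] that]
    unfolding ins .
  have "weight (\<lambda>k. 1 / of_nat k) h h \<pi> =
      1 / of_nat (hook \<pi> V) * h V * (\<Prod>W\<in>\<pi> - {V}. 1 / of_nat (hook \<pi> W) * h W)"
    unfolding weight_same[OF fin(1)] by (rule prod.remove[OF fin(1) V])
  also have "(\<Prod>W\<in>\<pi> - {V}. 1 / of_nat (hook \<pi> W) * h W) = weight (\<lambda>k. 1 / of_nat k) h h (\<pi> - {V})"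
    unfolding weight_same[OF fin(2)] using hk by (intro prod.cong) auto
  finally have "weight (\<lambda>k. 1 / of_nat k) h h \<pi> =
      1 / of_nat (hook \<pi> V) * h V * weight (\<lambda>k. 1 / of_nat k) h h (\<pi> - {V})" .
  moreover have "of_nat (hook \<pi> V) \<noteq> (0 :: complex)" using hook_pos[OF fin(1) V] by simp
  ultimately show ?thesis by (simp only: mult.assoc[symmetric] times_divide_eq_right) simp
qed

text \<open>If \<open>h\<close> are monotone cumulants, this interpolates between the left unit of \<open>gap_comp\<close> at \<open>s = 0\<close> and
  the moments at \<open>s = 1\<close>.\<close>

definition flow :: "(nat set \<Rightarrow> complex) \<Rightarrow> complex \<Rightarrow> nat set \<Rightarrow> complex" where
  "flow h s = NC_sum (\<lambda>k. s / of_nat k) h h"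

lemma flow_empty [simp]: "flow h s {} = 1"
  by (simp add: flow_def)

text \<open>Differentiation gives the factor \<open>card \<pi>\<close>, which is distributed over the outer blocks as the sum of
  their hooks; each summand then is \<open>h\<close> at that outer block times the weight of the other blocks.\<close>

lemma has_field_derivative_flow:
  assumes "finite S"
  shows "((\<lambda>s. flow h s S) has_field_derivative gap_comp (\<lambda>V. if V = {} then 0 else h V) (flow h s) S) (at s)"
proof -
  let ?w = "weight (\<lambda>k. 1 / of_nat k) h h"
  have fin: "finite \<pi>" if "\<pi> \<in> NC_on S" for \<pi> using NC_on_finite[OF assms that] .
  have "flow h s S = (\<Sum>\<pi>\<in>NC_on S. s ^ card \<pi> * ?w \<pi>)" for s
    unfolding flow_def NC_sum_def by (intro sum.cong refl weight_scale fin)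
  moreover have "((\<lambda>s. \<Sum>\<pi>\<in>NC_on S. s ^ card \<pi> * ?w \<pi>) has_field_derivative
      (\<Sum>\<pi>\<in>NC_on S. of_nat (card \<pi>) * s ^ (card \<pi> - 1) * ?w \<pi>)) (at s)"
    by (auto intro!: derivative_eq_intros simp: mult_ac)
  moreover have "(\<Sum>\<pi>\<in>NC_on S. of_nat (card \<pi>) * s ^ (card \<pi> - 1) * ?w \<pi>) =
      gap_comp (\<lambda>V. if V = {} then 0 else h V) (flow h s) S"
  proof -
    have "(\<Sum>\<pi>\<in>NC_on S. of_nat (card \<pi>) * s ^ (card \<pi> - 1) * ?w \<pi>) =
        (\<Sum>\<pi>\<in>NC_on S. \<Sum>V\<in>outer_blocks \<pi>. h V * weight (\<lambda>k. s / of_nat k) h h (\<pi> - {V}))"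
    proof (rule sum.cong[OF refl])
      fix \<pi> assume \<pi>: "\<pi> \<in> NC_on S"
      have "of_nat (card \<pi>) * s ^ (card \<pi> - 1) * ?w \<pi> =
          (\<Sum>V\<in>outer_blocks \<pi>. s ^ (card \<pi> - 1) * (of_nat (hook \<pi> V) * ?w \<pi>))"
        by (simp add: card_eq_sum_hook[OF \<pi> assms] sum_distrib_left sum_distrib_right mult_ac)
      also have "\<dots> = (\<Sum>V\<in>outer_blocks \<pi>. h V * weight (\<lambda>k. s / of_nat k) h h (\<pi> - {V}))"
      proof (rule sum.cong[OF refl])
        fix V assume V: "V \<in> outer_blocks \<pi>"
        then have "V \<in> \<pi>" using outer_blocks_subset by blast
        then have "card (\<pi> - {V}) = card \<pi> - 1" using fin[OF \<pi>] by simp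
        then show "s ^ (card \<pi> - 1) * (of_nat (hook \<pi> V) * ?w \<pi>) =
            h V * weight (\<lambda>k. s / of_nat k) h h (\<pi> - {V})"
          unfolding hook_weight_remove_outer[OF assms \<pi> V]
          using weight_scale[of "\<pi> - {V}" s h h] fin[OF \<pi>] by simp
      qed
      finally show "of_nat (card \<pi>) * s ^ (card \<pi> - 1) * ?w \<pi> =
          (\<Sum>V\<in>outer_blocks \<pi>. h V * weight (\<lambda>k. s / of_nat k) h h (\<pi> - {V}))" .
    qed
    also have "\<dots> = (\<Sum>V\<in>Pow S - {{}}. h V * gap_product (flow h s) S V)"
      unfolding flow_def sum_outer_blocks[OF assms, of "\<lambda>V \<rho>. h V * weight (\<lambda>k. s / of_nat k) h h \<rho>"]
      using assms by (intro sum.cong) (auto simp: sum_NC_gaps_weight[symmetric] sum_distrib_left)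
    also have "\<dots> = gap_comp (\<lambda>V. if V = {} then 0 else h V) (flow h s) S"
      unfolding gap_comp_def using assms by (intro sum.mono_neutral_cong_left) auto
    finally show ?thesis .
  qed
  ultimately show ?thesis by simp
qed

text \<open>Both sides agree at \<open>s = 0\<close>, where the flow is the left unit. By associativity their derivatives in
  \<open>s\<close> are the two sides composed on the left with \<open>h\<close>, set to zero at the empty set; such a composition
  sees proper subsets only, where the sides agree by induction.\<close>

lemma gap_comp_flow:
  assumes "finite S"
  shows "gap_comp (flow h s) (flow h t) S = flow h (s + t) S"
  using assms
proof (induction "card S" arbitrary: S s rule: less_induct)
  case less
  let ?h = "\<lambda>V. if V = {} then 0 else h V"
  have fin: "finite V" if "V \<subseteq> S" for V using that less.prems by (rule finite_subset)
  let ?D = "\<lambda>s. gap_comp ?h (flow h (s + t)) S"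
  show ?case
  proof (rule eq_of_same_derivative[where F = "\<lambda>s. gap_comp (flow h s) (flow h t) S"
        and G = "\<lambda>s. flow h (s + t) S" and D = ?D])
    fix s
    have "((\<lambda>s. gap_comp (flow h s) (flow h t) S) has_field_derivative
        gap_comp (gap_comp ?h (flow h s)) (flow h t) S) (at s)"
      using has_field_derivative_flow fin by (intro has_field_derivative_gap_comp_left) auto
    also have "gap_comp (gap_comp ?h (flow h s)) (flow h t) S = gap_comp ?h (gap_comp (flow h s) (flow h t)) S"
      by (rule gap_comp_assoc[OF less.prems])
    also have "\<dots> = ?D s"
      using less.hyps fin less.prems
      by (intro gap_comp_cong_right) (auto simp: psubset_card_mono)
    finally show "((\<lambda>s. gap_comp (flow h s) (flow h t) S) has_field_derivative ?D s) (at s)" .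
    show "((\<lambda>s. flow h (s + t) S) has_field_derivative ?D s) (at s)"
      using has_field_derivative_flow[OF less.prems, of h "s + t"] by (simp add: DERIV_shift)
  next
    have "gap_comp (flow h 0) (flow h t) S = gap_comp (\<lambda>V. if V = {} then 1 else 0) (flow h t) S"
      using NC_sum_zero fin unfolding flow_def by (intro gap_comp_cong_left) blast
    then show "gap_comp (flow h 0) (flow h t) S = flow h (0 + t) S"
      using gap_comp_unit_left[OF less.prems] by simp
  qed
qed

definition irr_flow :: "(nat set \<Rightarrow> complex) \<Rightarrow> (nat set \<Rightarrow> complex) \<Rightarrow> complex \<Rightarrow> nat set \<Rightarrow> complex" where
  "irr_flow f h s = irr_sum (\<lambda>k. s / of_nat k) f h"

lemma irr_sum_eq:
  assumes "finite S" "S \<noteq> {}"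
  shows "irr_sum u f g S = (\<Sum>V\<in>{V\<in>Pow S. Min S \<in> V \<and> Max S \<in> V}. \<Sum>\<rho>\<in>NC_gaps S V.
    u (Suc (card \<rho>)) * f V * weight u g g \<rho>)"
  unfolding irr_sum_def sum_NC_irr_on[OF assms]
  using assms by (intro sum.cong refl) (auto intro!: weight_insert_irr)

lemma irr_sum_one:
  assumes "finite S" "S \<noteq> {}"
  shows "irr_sum (\<lambda>_. 1) f g S = closed_comp f (NC_sum (\<lambda>_. 1) g g) S"
  unfolding irr_sum_eq[OF assms] closed_comp_eq_sum[OF assms(1)]
  using assms(1) by (intro sum.cong refl) (auto simp: sum_NC_gaps_weight[symmetric] sum_distrib_left)

text \<open>The hook of the unique outer block is the number of all blocks, that is the exponent of \<open>s\<close>, so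
  differentiation cancels it.\<close>

lemma has_field_derivative_irr_flow:
  assumes "finite S" "S \<noteq> {}"
  shows "((\<lambda>s. irr_flow f h s S) has_field_derivative closed_comp f (flow h s) S) (at s)"
proof -
  let ?E = "{V\<in>Pow S. Min S \<in> V \<and> Max S \<in> V}" and ?w = "weight (\<lambda>k. 1 / of_nat k) h h"
  have pow: "((\<lambda>s. s ^ Suc n) has_field_derivative of_nat (Suc n) * s ^ n) (at s)" for n and s :: complex
    using DERIV_power_Suc[OF DERIV_ident, of n s UNIV] by simp
  have scale: "weight (\<lambda>k. s / of_nat k) h h \<rho> = s ^ card \<rho> * ?w \<rho>"
    if "\<rho> \<in> NC_gaps S V" for \<rho> V s
    using weight_scale[of \<rho> s h h] NC_on_finite[of "S - V" \<rho>] that assms(1)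
    by (simp add: NC_gaps_def)
  have "irr_flow f h s S = (\<Sum>V\<in>?E. \<Sum>\<rho>\<in>NC_gaps S V.
      s ^ Suc (card \<rho>) * (f V * ?w \<rho> / of_nat (Suc (card \<rho>))))" for s
    unfolding irr_flow_def irr_sum_eq[OF assms]
    by (intro sum.cong refl) (subst scale, assumption, simp)
  moreover have "((\<lambda>s. \<Sum>V\<in>?E. \<Sum>\<rho>\<in>NC_gaps S V.
      s ^ Suc (card \<rho>) * (f V * ?w \<rho> / of_nat (Suc (card \<rho>)))) has_field_derivative
      (\<Sum>V\<in>?E. \<Sum>\<rho>\<in>NC_gaps S V.
      of_nat (Suc (card \<rho>)) * s ^ card \<rho> * (f V * ?w \<rho> / of_nat (Suc (card \<rho>))))) (at s)"
    by (intro DERIV_sum DERIV_cmult_right pow)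
  moreover have "(\<Sum>V\<in>?E. \<Sum>\<rho>\<in>NC_gaps S V.
      of_nat (Suc (card \<rho>)) * s ^ card \<rho> * (f V * ?w \<rho> / of_nat (Suc (card \<rho>)))) =
      closed_comp f (flow h s) S"
    unfolding closed_comp_eq_sum[OF assms(1)]
  proof (rule sum.cong[OF refl])
    fix V assume "V \<in> ?E"
    then have "gap_product (flow h s) S V =
        (\<Sum>\<rho>\<in>NC_gaps S V. weight (\<lambda>k. s / of_nat k) h h \<rho>)"
      unfolding flow_def using assms(1) by (simp add: sum_NC_gaps_weight)
    also have "\<dots> = (\<Sum>\<rho>\<in>NC_gaps S V. s ^ card \<rho> * ?w \<rho>)"
      by (intro sum.cong refl scale)
    finally have "gap_product (flow h s) S V = (\<Sum>\<rho>\<in>NC_gaps S V. s ^ card \<rho> * ?w \<rho>)" .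
    then show "(\<Sum>\<rho>\<in>NC_gaps S V.
        of_nat (Suc (card \<rho>)) * s ^ card \<rho> * (f V * ?w \<rho> / of_nat (Suc (card \<rho>)))) =
        f V * gap_product (flow h s) S V"
      by (simp add: sum_distrib_left mult_ac del: of_nat_Suc)
  qed
  ultimately show ?thesis by simp
qed

lemma irr_flow_zero:
  assumes "finite S" "S \<noteq> {}"
  shows "irr_flow f h 0 S = 0"
  unfolding irr_flow_def irr_sum_eq[OF assms] by simp

text \<open>As functions of \<open>s\<close> the two sides have the same derivative by the flow property, and they agree at
  \<open>s = 0\<close>.\<close>

lemma irr_flow_add:
  assumes "finite S" "S \<noteq> {}"
  shows "irr_flow f h (s + t) S = closed_comp (irr_flow f h s) (flow h t) S + irr_flow f h t S"
proof (rule eq_of_same_derivative[where F = "\<lambda>s. irr_flow f h (s + t) S"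
      and G = "\<lambda>s. closed_comp (irr_flow f h s) (flow h t) S + irr_flow f h t S"
      and D = "\<lambda>s. closed_comp f (flow h (s + t)) S"])
  fix s
  show "((\<lambda>s. irr_flow f h (s + t) S) has_field_derivative closed_comp f (flow h (s + t)) S) (at s)"
    using has_field_derivative_irr_flow[OF assms, of f h "s + t"] by (simp add: DERIV_shift)
  have "((\<lambda>s. gap_comp (\<lambda>V. if Min S \<in> V \<and> Max S \<in> V then irr_flow f h s V else 0) (flow h t) S)
      has_field_derivative
      gap_comp (\<lambda>V. if Min S \<in> V \<and> Max S \<in> V then closed_comp f (flow h s) V else 0) (flow h t) S) (at s)"
  proof (rule has_field_derivative_gap_comp_left)
    fix V assume "V \<subseteq> S"
    then have "finite V" using assms(1) finite_subset by blast
    then show "((\<lambda>s. if Min S \<in> V \<and> Max S \<in> V then irr_flow f h s V else 0) has_field_derivative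
        (if Min S \<in> V \<and> Max S \<in> V then closed_comp f (flow h s) V else 0)) (at s)"
      using has_field_derivative_irr_flow[of V f h s] by auto
  qed
  then have "((\<lambda>s. closed_comp (irr_flow f h s) (flow h t) S) has_field_derivative
      closed_comp (closed_comp f (flow h s)) (flow h t) S) (at s)"
    by (simp only: closed_comp_def[of "irr_flow f h _"] closed_comp_def[of "closed_comp _ _"])
  also have "closed_comp (closed_comp f (flow h s)) (flow h t) S = closed_comp f (flow h (s + t)) S"
    unfolding closed_comp_assoc[OF assms(1)]
    by (rule closed_comp_cong_right[OF assms(1)]) (rule gap_comp_flow)
  finally show "((\<lambda>s. closed_comp (irr_flow f h s) (flow h t) S + irr_flow f h t S)
      has_field_derivative closed_comp f (flow h (s + t)) S) (at s)"
    using DERIV_add[OF _ DERIV_const] by fastforce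
next
  have "closed_comp (irr_flow f h 0) (flow h t) S = 0"
    unfolding closed_comp_eq_sum[OF assms(1)]
    using assms(1) irr_flow_zero by (intro sum.neutral) (auto dest: finite_subset)
  then show "irr_flow f h (0 + t) S = closed_comp (irr_flow f h 0) (flow h t) S + irr_flow f h t S"
    by simp
qed

text \<open>Both \<open>kc\<close> and \<open>- irr_flow hc h' (- 1)\<close>, composed with the moments of \<open>\<psi>\<close>, give the Boolean
  cumulants of \<open>\<phi>\<close>: the former by the free expansion inside the gaps, the latter by the cocycle
  identity at \<open>-1 + 1 = 0\<close>.\<close>

lemma cfree_eq_irr_flow:
  assumes "\<And>S. finite S \<Longrightarrow> S \<noteq> {} \<Longrightarrow> NC_sum (\<lambda>_. 1) kc k' S = NC_sum (\<lambda>k. 1 / of_nat k) hc h' S"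
    and "\<And>S. finite S \<Longrightarrow> S \<noteq> {} \<Longrightarrow> NC_sum (\<lambda>_. 1) k' k' S = NC_sum (\<lambda>k. 1 / of_nat k) h' h' S"
    and "finite S" "S \<noteq> {}"
  shows "kc S = - irr_flow hc h' (- 1) S"
proof (rule closed_comp_cancel[where g = "flow h' 1", OF _ _ assms(3,4)])
  fix S :: "nat set" assume S: "finite S" "S \<noteq> {}"
  have "closed_comp kc (flow h' 1) S = closed_comp kc (NC_sum (\<lambda>_. 1) k' k') S"
  proof (rule closed_comp_cong_right[OF S(1)])
    show "flow h' 1 T = NC_sum (\<lambda>_. 1) k' k' T" if "finite T" for T
      using assms(2)[OF that] by (cases "T = {}") (auto simp: flow_def)
  qed
  also have "\<dots> = irr_sum (\<lambda>_. 1) kc k' S" by (rule irr_sum_one[OF S, symmetric])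
  also have "\<dots> = irr_flow hc h' 1 S"
    unfolding irr_flow_def by (rule irr_sum_unique[OF assms(1) S])
  also have "\<dots> = - closed_comp (irr_flow hc h' (- 1)) (flow h' 1) S"
    using irr_flow_add[OF S, of hc h' "- 1" 1] irr_flow_zero[OF S]
    by (simp add: eq_neg_iff_add_eq_0 add.commute)
  also have "\<dots> = closed_comp (\<lambda>V. - irr_flow hc h' (- 1) V) (flow h' 1) S"
    by (simp add: closed_comp_eq_sum[OF S(1)] sum_negf)
  finally show "closed_comp kc (flow h' 1) S =
      closed_comp (\<lambda>V. - irr_flow hc h' (- 1) V) (flow h' 1) S" .
qed simp

section \<open>Relabelling and moment formulas on subsets\<close>

lemma NC_on_image:
  assumes "strict_mono_on S e" "\<pi> \<in> NC_on S"
  shows "(`) e ` \<pi> \<in> NC_on (e ` S)"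
proof -
  have inj: "inj_on e S" using assms(1) by (rule strict_mono_on_imp_inj_on)
  have "{} \<notin> (`) e ` \<pi>" using NC_on_block(2)[OF assms(2)] by auto
  then have "partition_on (e ` S) ((`) e ` \<pi>)"
    using partition_on_inj_image[OF NC_onD(1)[OF assms(2)] inj] by simp
  moreover have "noncrossing ((`) e ` \<pi>)"
    unfolding noncrossing_def
  proof (intro ballI impI notI, elim exE conjE)
    fix V W a b c d
    assume VW: "V \<in> (`) e ` \<pi>" "W \<in> (`) e ` \<pi>" "V \<noteq> W"
      and o: "a < b" "b < c" "c < (d::nat)" "a \<in> V" "c \<in> V" "b \<in> W" "d \<in> W"
    from VW obtain V' W' where V': "V = e ` V'" "V' \<in> \<pi>" and W': "W = e ` W'" "W' \<in> \<pi>" by auto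
    from o V' W' obtain a' b' c' d' where ab: "a = e a'" "b = e b'" "c = e c'" "d = e d'"
      "a' \<in> V'" "c' \<in> V'" "b' \<in> W'" "d' \<in> W'" by auto
    have "a' \<in> S" "b' \<in> S" "c' \<in> S" "d' \<in> S"
      using ab NC_on_block(1)[OF assms(2) V'(2)] NC_on_block(1)[OF assms(2) W'(2)] by auto
    then have "a' < b'" "b' < c'" "c' < d'"
      using o ab strict_mono_on_less[OF assms(1)] by auto
    then show False using NC_on_noncross[OF assms(2) V'(2) W'(2)] VW(3) V'(1) W'(1) ab by blast
  qed
  ultimately show ?thesis by (simp add: NC_on_def)
qed

lemma bij_betw_NC_on_image:
  assumes "strict_mono_on S e"
  shows "bij_betw ((`) ((`) e)) (NC_on S) (NC_on (e ` S))"
proof -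
  have inj: "inj_on e S" using assms by (rule strict_mono_on_imp_inj_on)
  let ?e = "inv_into S e"
  have mono: "strict_mono_on (e ` S) ?e"
    using assms inj by (auto simp: strict_mono_on_def inv_into_f_f strict_mono_on_less[OF assms])
  have img: "?e ` (e ` S) = S" using inj by (simp add: inv_into_image_cancel)
  show ?thesis
  proof (rule bij_betw_byWitness[where f' = "(`) ((`) ?e)"])
    show "\<forall>\<pi>\<in>NC_on S. (`) ?e ` (`) e ` \<pi> = \<pi>"
    proof
      fix \<pi> assume \<pi>: "\<pi> \<in> NC_on S"
      have "?e ` e ` V = V" if "V \<in> \<pi>" for V
        using inv_into_image_cancel[OF inj] NC_on_block(1)[OF \<pi> that] by simp
      then show "(`) ?e ` (`) e ` \<pi> = \<pi>" by (simp add: image_image)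
    qed
    show "\<forall>\<pi>\<in>NC_on (e ` S). (`) e ` (`) ?e ` \<pi> = \<pi>"
    proof
      fix \<pi> assume \<pi>: "\<pi> \<in> NC_on (e ` S)"
      have "e ` ?e ` V = V" if "V \<in> \<pi>" for V
        using image_inv_into_cancel[OF refl NC_on_block(1)[OF \<pi> that]] .
      then show "(`) e ` (`) ?e ` \<pi> = \<pi>" by (simp add: image_image)
    qed
    show "(`) ((`) e) ` NC_on S \<subseteq> NC_on (e ` S)" using NC_on_image[OF assms] by blast
    show "(`) ((`) ?e) ` NC_on (e ` S) \<subseteq> NC_on S" using NC_on_image[OF mono] unfolding img by blast
  qed
qed

lemma nests_image:
  assumes "strict_mono_on S e" "V \<subseteq> S" "W \<subseteq> S"
  shows "nests (e ` V) (e ` W) \<longleftrightarrow> nests V W"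
proof -
  have "e x < e y \<longleftrightarrow> x < y" if "x \<in> V \<union> W" "y \<in> V \<union> W" for x y
    using strict_mono_on_less[OF assms(1)] that assms(2,3) by auto
  then show ?thesis unfolding nests_def by auto
qed

lemma weight_image:
  assumes "strict_mono_on S e" "\<pi> \<in> NC_on S"
  shows "weight u f g ((`) e ` \<pi>) = weight u (\<lambda>V. f (e ` V)) (\<lambda>V. g (e ` V)) \<pi>"
proof -
  have inj: "inj_on e S" using assms(1) by (rule strict_mono_on_imp_inj_on)
  have sub: "V \<subseteq> S" if "V \<in> \<pi>" for V using NC_on_block(1)[OF assms(2) that] .
  have inj\<pi>: "inj_on ((`) e) \<pi>"
    using inj_on_image_Pow[OF inj] by (rule inj_on_subset) (use sub in auto)
  have n: "nests (e ` V) (e ` W) \<longleftrightarrow> nests V W" if "V \<in> \<pi>" "W \<in> \<pi>" for V W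
    using nests_image[OF assms(1)] sub that by blast
  have eq: "e ` V = e ` W \<longleftrightarrow> V = W" if "V \<in> \<pi>" "W \<in> \<pi>" for V W
    using inj\<pi> that by (auto dest: inj_onD)
  have "below ((`) e ` \<pi>) (e ` V) = (`) e ` below \<pi> V" if "V \<in> \<pi>" for V
    unfolding below_def using n eq that by auto
  then have hook: "hook ((`) e ` \<pi>) (e ` V) = hook \<pi> V" if "V \<in> \<pi>" for V
    unfolding hook_def using that
    by (simp add: card_image inj_on_subset[OF inj\<pi>] below_def)
  have outer: "outer_blocks ((`) e ` \<pi>) = (`) e ` outer_blocks \<pi>"
    unfolding outer_blocks_def using n by auto
  have inner: "inner_blocks ((`) e ` \<pi>) = (`) e ` inner_blocks \<pi>"
    unfolding inner_blocks_def outer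
    by (rule inj_on_image_set_diff[OF inj\<pi>, symmetric]) (auto simp: outer_blocks_def)
  have "inj_on ((`) e) (outer_blocks \<pi>)" "inj_on ((`) e) (inner_blocks \<pi>)"
    using inj_on_subset[OF inj\<pi>] by (auto simp: outer_blocks_def inner_blocks_def)
  then show ?thesis
    unfolding weight_def outer inner
    by (simp add: prod.reindex inj\<pi> hook)
qed

lemma NC_sum_image:
  assumes "strict_mono_on S e"
  shows "NC_sum u f g (e ` S) = NC_sum u (\<lambda>V. f (e ` V)) (\<lambda>V. g (e ` V)) S"
  unfolding NC_sum_def sum.reindex_bij_betw[OF bij_betw_NC_on_image[OF assms], symmetric]
  using weight_image[OF assms] by (intro sum.cong) auto

lemma NC_sum_cong:
  assumes "\<And>V. V \<subseteq> S \<Longrightarrow> V \<noteq> {} \<Longrightarrow> f V = f' V" "\<And>V. V \<subseteq> S \<Longrightarrow> V \<noteq> {} \<Longrightarrow> g V = g' V"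
  shows "NC_sum u f g S = NC_sum u f' g' S"
  unfolding NC_sum_def
proof (rule sum.cong[OF refl])
  fix \<pi> assume \<pi>: "\<pi> \<in> NC_on S"
  have "f V = f' V" "g V = g' V" if "V \<in> \<pi>" for V
    using assms NC_on_block[OF \<pi> that] by auto
  then show "weight u f g \<pi> = weight u f' g' \<pi>"
    unfolding weight_def outer_blocks_def inner_blocks_def
    by (intro arg_cong2[where f = "(*)"] prod.cong) auto
qed

lemma sorted_list_of_set_image:
  assumes "strict_mono_on S (e :: nat \<Rightarrow> nat)" "V \<subseteq> S" "finite V"
  shows "sorted_list_of_set (e ` V) = map e (sorted_list_of_set V)"
proof -
  have m: "strict_mono_on V e" using assms(1,2) by (auto simp: strict_mono_on_def)
  have "sorted (map e (sorted_list_of_set V))"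
    using strict_mono_on_imp_mono_on[OF m] assms(3)
    by (intro sorted_map_mono) (auto simp: mono_on_def)
  moreover have "distinct (map e (sorted_list_of_set V))"
    using strict_mono_on_imp_inj_on[OF m] assms(3) by (simp add: distinct_map)
  ultimately show ?thesis
    using assms(3) by (intro sorted_distinct_set_unique) auto
qed

text \<open>The defining formulas speak of \<open>{1..n}\<close> with arbitrary arguments. Enumerating \<open>S\<close> increasingly turns
  them into formulas for a subset \<open>S\<close> of positions with \<open>a\<close> fixed, the form in which gaps need them.\<close>

lemma moment_formula_on:
  assumes "\<And>n a. n \<ge> 1 \<Longrightarrow>
      \<phi> (prod_list (map a [1..<Suc n])) = NC_sum u (on_block f a) (on_block g a) {1..n}"
    and "finite S" "S \<noteq> {}"
  shows "\<phi> (prod_list (map a (sorted_list_of_set S))) = NC_sum u (on_block f a) (on_block g a) S"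
proof -
  define n where "n = card S"
  define e where "e i = sorted_list_of_set S ! (i - 1)" for i
  have n: "n \<ge> 1" using assms(2,3) by (simp add: n_def Suc_le_eq card_gt_0_iff)
  have list: "map e [1..<Suc n] = sorted_list_of_set S"
    by (rule nth_equalityI) (auto simp: e_def n_def simp del: upt_Suc)
  have mono: "strict_mono_on {1..n} e"
  proof (rule strict_mono_onI)
    fix i j assume "i \<in> {1..n}" "j \<in> {1..n}" "i < j"
    then show "e i < e j"
      using sorted_wrt_nth_less[OF strict_sorted_list_of_set[of S], of "i - 1" "j - 1"]
      by (auto simp: e_def n_def)
  qed
  have img: "e ` {1..n} = S"
    using arg_cong[OF list, of set] assms(2) by (simp add: atLeastLessThanSuc_atLeastAtMost del: upt_Suc)
  have block: "on_block f a (e ` V) = on_block f (a \<circ> e) V" if "V \<subseteq> {1..n}" for f V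
    using sorted_list_of_set_image[OF mono that] that finite_subset[OF that]
    by (simp add: on_block_def)
  have "\<phi> (prod_list (map a (sorted_list_of_set S))) = \<phi> (prod_list (map (a \<circ> e) [1..<Suc n]))"
    by (simp only: list[symmetric] map_map)
  also have "\<dots> = NC_sum u (on_block f (a \<circ> e)) (on_block g (a \<circ> e)) {1..n}"
    by (rule assms(1)[OF n])
  also have "\<dots> = NC_sum u (\<lambda>V. on_block f a (e ` V)) (\<lambda>V. on_block g a (e ` V)) {1..n}"
    by (rule NC_sum_cong) (simp_all add: block)
  also have "\<dots> = NC_sum u (on_block f a) (on_block g a) S"
    using NC_sum_image[OF mono] img by metis
  finally show ?thesis .
qed

lemma NC_eq_NC_on: "NC n = NC_on {1..n}"
  by (simp add: NC_def NC_on_def)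

lemma weight_one: "weight (\<lambda>_. 1) f g \<pi> = (\<Prod>V\<in>outer_blocks \<pi>. f V) * (\<Prod>V\<in>inner_blocks \<pi>. g V)"
  by (simp add: weight_def)

lemma weight_inverse_hook:
  assumes "\<pi> \<in> NC_on S" "finite S"
  shows "weight (\<lambda>k. 1 / of_nat k) f g \<pi> = 1 / of_nat (forest_fact (nesting_forest \<pi>)) *
    (\<Prod>V\<in>outer_blocks \<pi>. f V) * (\<Prod>V\<in>inner_blocks \<pi>. g V)"
  by (simp add: weight_def forest_fact_eq_prod_hook[OF assms] prod_dividef)

lemma free_cumulants_on:
  assumes "free_cumulants \<psi> k" "finite S" "S \<noteq> {}"
  shows "\<psi> (prod_list (map a (sorted_list_of_set S))) = NC_sum (\<lambda>_. 1) (on_block k a) (on_block k a) S"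
proof (rule moment_formula_on[OF _ assms(2,3)])
  fix n :: nat and a assume "n \<ge> 1"
  then have "\<psi> (prod_list (map a [1..<Suc n])) = (\<Sum>\<pi>\<in>NC_on {1..n}. \<Prod>V\<in>\<pi>. on_block k a V)"
    using assms(1) by (simp only: free_cumulants_def NC_eq_NC_on)
  also have "\<dots> = NC_sum (\<lambda>_. 1) (on_block k a) (on_block k a) {1..n}"
    unfolding NC_sum_def using NC_on_finite[of "{1..n}"] by (intro sum.cong) (auto simp: weight_same)
  finally show "\<psi> (prod_list (map a [1..<Suc n])) =
    NC_sum (\<lambda>_. 1) (on_block k a) (on_block k a) {1..n}" .
qed

lemma monotone_cumulants_on:
  assumes "monotone_cumulants \<psi> h" "finite S" "S \<noteq> {}"
  shows "\<psi> (prod_list (map a (sorted_list_of_set S))) =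
    NC_sum (\<lambda>k. 1 / of_nat k) (on_block h a) (on_block h a) S"
proof (rule moment_formula_on[OF _ assms(2,3)])
  fix n :: nat and a assume "n \<ge> 1"
  then have "\<psi> (prod_list (map a [1..<Suc n])) = (\<Sum>\<pi>\<in>NC_on {1..n}.
      1 / of_nat (forest_fact (nesting_forest \<pi>)) * (\<Prod>V\<in>\<pi>. on_block h a V))"
    using assms(1) by (simp only: monotone_cumulants_def NC_eq_NC_on)
  also have "\<dots> = NC_sum (\<lambda>k. 1 / of_nat k) (on_block h a) (on_block h a) {1..n}"
    unfolding NC_sum_def
  proof (rule sum.cong[OF refl])
    fix \<pi> assume \<pi>: "\<pi> \<in> NC_on {1..n}"
    then have "finite \<pi>" using NC_on_finite by blast
    from prod_outer_inner[OF this, of "on_block h a"]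
    show "1 / of_nat (forest_fact (nesting_forest \<pi>)) * (\<Prod>V\<in>\<pi>. on_block h a V) =
        weight (\<lambda>k. 1 / of_nat k) (on_block h a) (on_block h a) \<pi>"
      by (simp only: weight_inverse_hook[OF \<pi> finite_atLeastAtMost] mult.assoc)
  qed
  finally show "\<psi> (prod_list (map a [1..<Suc n])) =
    NC_sum (\<lambda>k. 1 / of_nat k) (on_block h a) (on_block h a) {1..n}" .
qed

lemma NC_sum_split_one_block:
  assumes "finite S" "S \<noteq> {}"
  shows "NC_sum u f f S = u 1 * f S + (\<Sum>\<pi>\<in>NC_on S - {{S}}. weight u f f \<pi>)"
    and "\<pi> \<in> NC_on S - {{S}} \<Longrightarrow> V \<in> \<pi> \<Longrightarrow> V \<subset> S"
proof -
  have top: "{S} \<in> NC_on S"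
    using assms(2) by (auto simp: NC_on_def partition_on_def noncrossing_def)
  have "below {S} S = {S}" by (auto simp: below_def)
  then have "weight u f f {S} = u 1 * f S" by (simp add: weight_same hook_def)
  then show "NC_sum u f f S = u 1 * f S + (\<Sum>\<pi>\<in>NC_on S - {{S}}. weight u f f \<pi>)"
    unfolding NC_sum_def by (subst sum.remove[OF finite_NC_on[OF assms(1)] top]) simp
  assume \<pi>: "\<pi> \<in> NC_on S - {{S}}" "V \<in> \<pi>"
  then have "\<pi> \<in> NC_on S" by blast
  note block = NC_on_block[OF this] and disj = NC_on_disjoint[OF this]
  have "V \<noteq> S"
  proof
    assume "V = S"
    have "W = S" if W: "W \<in> \<pi>" for W
    proof -
      obtain x where "x \<in> W" using block(2)[OF W] by blast
      moreover have "x \<in> V" using subsetD[OF block(1)[OF W] \<open>x \<in> W\<close>] \<open>V = S\<close> by simp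
      ultimately show ?thesis using disj[OF W \<pi>(2)] \<open>V = S\<close> by metis
    qed
    with \<pi>(2) have "\<pi> = {S}" by blast
    with \<pi>(1) show False by blast
  qed
  then show "V \<subset> S" using block(1)[OF \<pi>(2)] by blast
qed

text \<open>Monotone cumulants are unique: the partition with the single block \<open>S\<close> contributes \<open>u 1 * f S\<close>, every
  other one involves proper subsets. This identifies the monotone cumulants hidden in the definition of
  c-monotone cumulants with the given ones.\<close>

lemma NC_sum_determines_blocks:
  assumes "u 1 \<noteq> 0"
    and "\<And>S. finite S \<Longrightarrow> S \<noteq> {} \<Longrightarrow> NC_sum u f f S = NC_sum u g g S"
  shows "finite S \<Longrightarrow> S \<noteq> {} \<Longrightarrow> f S = g S"
proof (induction "card S" arbitrary: S rule: less_induct)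
  case less
  have "(\<Sum>\<pi>\<in>NC_on S - {{S}}. weight u f f \<pi>) = (\<Sum>\<pi>\<in>NC_on S - {{S}}. weight u g g \<pi>)"
  proof (rule sum.cong[OF refl])
    fix \<pi> assume \<pi>: "\<pi> \<in> NC_on S - {{S}}"
    then have fin: "finite \<pi>" using NC_on_finite[OF less.prems(1)] by blast
    have "f V = g V" if V: "V \<in> \<pi>" for V
    proof (rule less.hyps)
      have "V \<subset> S" using NC_sum_split_one_block(2)[OF less.prems \<pi> V] .
      then show "card V < card S" "finite V"
        using less.prems(1) psubset_card_mono finite_subset by auto
      show "V \<noteq> {}" using NC_on_block(2)[of \<pi> S V] \<pi> V by blast
    qed
    then show "weight u f f \<pi> = weight u g g \<pi>" by (simp add: weight_same[OF fin])
  qed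
  then show ?case
    using NC_sum_split_one_block(1)[OF less.prems, of u f] NC_sum_split_one_block(1)[OF less.prems, of u g]
      assms(2)[OF less.prems] assms(1) by simp
qed

section \<open>The c-free cumulants\<close>

text \<open>The block of \<open>1\<close> is the only outer block of an irreducible partition; the leading minus sign turns
  \<open>(-1) ^ |\<pi>|\<close> into \<open>(-1) ^ (|\<pi>| - 1)\<close>.\<close>

lemma irr_flow_minus_one:
  assumes "n \<ge> 1"
  shows "- irr_flow f g (- 1) {1..n} =
    (\<Sum>\<pi>\<in>NC_irr n. (-1) ^ (card \<pi> - 1) / of_nat (forest_fact (nesting_forest \<pi>)) *
        f (block_of \<pi> 1) * (\<Prod>V\<in>\<pi> - {block_of \<pi> 1}. g V))"
proof -
  have MM: "Min {1..n} = 1" "Max {1..n} = n" using assms by (auto intro: Min_eqI Max_eqI)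
  have irr: "NC_irr n = NC_irr_on {1..n}"
    unfolding NC_irr_def NC_irr_on_def MM NC_eq_NC_on ..
  show ?thesis
    unfolding irr_flow_def irr_sum_def irr sum_negf[symmetric]
  proof (rule sum.cong[OF refl])
    fix \<pi> assume "\<pi> \<in> NC_irr_on {1..n}"
    then obtain V where V: "\<pi> \<in> NC_on {1..n}" "V \<in> \<pi>" "1 \<in> V" "n \<in> V"
      unfolding NC_irr_on_def MM by blast
    have fin: "finite \<pi>" using NC_on_finite[OF _ V(1)] by simp
    have b: "block_of \<pi> 1 = V" using block_of_eq[OF V(1-3)] .
    have outer: "outer_blocks \<pi> = {V}" using irr_block_outer(1)[OF V(1) _ V(2)] V(3,4) MM by simp
    have "card \<pi> = Suc (card \<pi> - 1)" using fin V(2) by (metis card_gt_0_iff empty_iff Suc_pred')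
    then have "(- 1 :: complex) ^ card \<pi> = - ((- 1) ^ (card \<pi> - 1))"
      by (metis mult_minus1 power_Suc)
    then show "- weight (\<lambda>k. (- 1) / of_nat k) f g \<pi> =
        (-1) ^ (card \<pi> - 1) / of_nat (forest_fact (nesting_forest \<pi>)) *
        f (block_of \<pi> 1) * (\<Prod>V\<in>\<pi> - {block_of \<pi> 1}. g V)"
      by (simp only: weight_scale[OF fin, of "- 1"] weight_inverse_hook[OF V(1) finite_atLeastAtMost]
          inner_blocks_def outer b) simp
  qed
qed

theorem theorem6p2:
  fixes scale :: "complex \<Rightarrow> 'a::ring_1 \<Rightarrow> 'a"
    and \<phi> \<psi> :: "'a \<Rightarrow> complex"
    and kc hc h' :: "'a list \<Rightarrow> complex"
    and n :: nat
    and a :: "nat \<Rightarrow> 'a"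
  assumes "cond_ncps scale \<phi> \<psi>"
    and "cmonotone_cumulants \<phi> \<psi> hc"
    and "cfree_cumulants \<phi> \<psi> kc"
    and "monotone_cumulants \<psi> h'"
    and "n \<ge> 1"
  shows "kc (map a [1..<Suc n]) =
    (\<Sum>\<pi>\<in>NC_irr n. (-1) ^ (card \<pi> - 1) / of_nat (forest_fact (nesting_forest \<pi>)) *
        on_block hc a (block_of \<pi> 1) *
        (\<Prod>V\<in>\<pi> - {block_of \<pi> 1}. on_block h' a V))"
proof -
  obtain k' where k': "free_cumulants \<psi> k'"
    and kc: "\<And>n a. n \<ge> 1 \<Longrightarrow> \<phi> (prod_list (map a [1..<Suc n])) =
      NC_sum (\<lambda>_. 1) (on_block kc a) (on_block k' a) {1..n}"
    using assms(3) unfolding cfree_cumulants_def NC_sum_def weight_one NC_eq_NC_on by blast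
  obtain h where h: "monotone_cumulants \<psi> h"
    and hc: "\<And>n a. n \<ge> 1 \<Longrightarrow> \<phi> (prod_list (map a [1..<Suc n])) =
      (\<Sum>\<pi>\<in>NC_on {1..n}. 1 / of_nat (forest_fact (nesting_forest \<pi>)) *
        (\<Prod>V\<in>outer_blocks \<pi>. on_block hc a V) * (\<Prod>V\<in>inner_blocks \<pi>. on_block h a V))"
    using assms(2) unfolding cmonotone_cumulants_def NC_eq_NC_on by blast
  have hc': "\<phi> (prod_list (map a [1..<Suc n])) =
      NC_sum (\<lambda>k. 1 / of_nat k) (on_block hc a) (on_block h a) {1..n}" if "n \<ge> 1" for n a
    unfolding hc[OF that] NC_sum_def by (intro sum.cong refl) (simp add: weight_inverse_hook)
  have hh': "on_block h a S = on_block h' a S" if "finite S" "S \<noteq> {}" for S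
    \<comment> \<open>both families reproduce the moments of \<open>\<psi>\<close>\<close>
    by (rule NC_sum_determines_blocks[OF _ _ that, where u = "\<lambda>k. 1 / of_nat k"])
      (simp_all add: monotone_cumulants_on[OF h, symmetric] monotone_cumulants_on[OF assms(4), symmetric])
  have "on_block kc a {1..n} = - irr_flow (on_block hc a) (on_block h' a) (- 1) {1..n}"
  proof (rule cfree_eq_irr_flow[where k' = "on_block k' a"])
    fix S :: "nat set" assume S: "finite S" "S \<noteq> {}"
    have "NC_sum (\<lambda>k. 1 / of_nat k) (on_block hc a) (on_block h a) S =
        NC_sum (\<lambda>k. 1 / of_nat k) (on_block hc a) (on_block h' a) S"
      using hh' S by (intro NC_sum_cong) (auto dest: finite_subset)
    then show "NC_sum (\<lambda>_. 1) (on_block kc a) (on_block k' a) S =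
        NC_sum (\<lambda>k. 1 / of_nat k) (on_block hc a) (on_block h' a) S"
      using moment_formula_on[OF kc S, of a] moment_formula_on[OF hc' S, of a] by simp
    show "NC_sum (\<lambda>_. 1) (on_block k' a) (on_block k' a) S =
        NC_sum (\<lambda>k. 1 / of_nat k) (on_block h' a) (on_block h' a) S"
      using free_cumulants_on[OF k' S, of a] monotone_cumulants_on[OF assms(4) S, of a] by simp
  qed (use assms(5) in auto)
  moreover have "on_block kc a {1..n} = kc (map a [1..<Suc n])"
    by (simp add: on_block_def atLeastLessThanSuc_atLeastAtMost[symmetric] del: upt_Suc)
  ultimately show ?thesis using irr_flow_minus_one[OF assms(5)] by simp
qed

end
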